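(* Let $q\ge 2$ be an integer which is either even, or a perfect square divisible by $3$ or by $5$. Then: (1) $\Lambda_q=\Gamma_q$ as subsets of $\mathbb{Z}/(q^2-1)\mathbb{Z}$; and thus (2) for every integer $k$ with $\gcd(k,q)=1$, there exist integers $a,b$ with $b\ge 1$ and $\gcd(a,b)=1$ such that $S(a,b)=\frac{k}{q}$ if and only if both of the following conditions hold: - if $3\nmid q$, then $3\mid k$; - if $2\nmid q$, then $k\equiv 2\pmod 4$ when $q\equiv 3\pmod 4$; $k\equiv 0\pmod 8$ when $q$ is a square; and $k\equiv 0\pmod 4$ in all remaining cases.
   Context: For coprime integers $a,b$ with $b>0$, the Dedekind sum is $s(a,b)=\sum_{k=1}^{b}\left(\!\left(\frac{k}{b}\right)\!\right)\left(\!\left(\frac{ak}{b}\right)\!\right)$, where $((x))=\{x\}-\frac12$ if $x\in\mathbb{R}\setminus\mathbb{Z}$ (with $\{x\}$ the fractional part) and $((x))=0$ if $x\in\mathbb{Z}$. The normalized Dedekind sum is $S(a,b)=12\,s(a,b)$. For an integer $q\ge 2$, define $$\Lambda_q=\left\{\frac{(q^2-1)a}{t}-qS(aq,t)\pmod{q^2-1} : a,t\in\mathbb{Z},\ t>0,\ t\mid a^2+1,\ \gcd(aq,t)=1\right\}\subseteq \mathbb{Z}/(q^2-1)\mathbb{Z}$$ (the expressions $\frac{(q^2-1)a}{t}-qS(aq,t)$ are integers for such $a,t$), and define $\Gamma_q\subseteq\mathbb{Z}/(q^2-1)\mathbb{Z}$ by $\Gamma_q=\{24s : s\in\mathbb{Z}/(q^2-1)\mathbb{Z}\}$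 if $q$ is a perfect square, and $\Gamma_q=\{12s : s\in\mathbb{Z}/(q^2-1)\mathbb{Z}\}$ otherwise. *)

theory Defs
  imports
    "HOL-Number_Theory.Number_Theory"
    "HOL-Computational_Algebra.Nth_Powers"
begin

definition sawtooth :: "real \<Rightarrow> real" where
  "sawtooth x = (if x \<in> \<int> then 0 else frac x - 1 / 2)"

text \<open>
  The Dedekind sum \<open>s(a, b)\<close> and its normalisation \<open>S(a, b) = 12 s(a, b)\<close>. They are
  meaningful for \<open>b > 0\<close> and coprime \<open>a, b\<close>; every use below carries these hypotheses.
\<close>

definition dedekind_sum :: "int \<Rightarrow> int \<Rightarrow> real" where
  "dedekind_sum a b =
     (\<Sum>k = 1..b. sawtooth (of_int k / of_int b) * sawtooth (of_int (a * k) / of_int b))"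

definition norm_dedekind_sum :: "int \<Rightarrow> int \<Rightarrow> real" where
  "norm_dedekind_sum a b = 12 * dedekind_sum a b"

text \<open>
  Subsets of \<open>\<int>/(q\<^sup>2 - 1)\<int>\<close> are represented as subsets of the carrier \<open>{0..q\<^sup>2 - 2}\<close> of
  \<^term>\<open>residue_ring (q\<^sup>2 - 1)\<close>, that is, by least nonnegative residues.

  For \<open>a, t\<close> as in \<open>Lambda_set\<close>, the real number \<open>(q\<^sup>2 - 1) a / t - q S(a q, t)\<close> is always an
  integer, so the equation for \<open>x\<close> merely names that integer and excludes no pair \<open>(a, t)\<close>.
\<close>

definition Lambda_set :: "int \<Rightarrow> int set" where
  "Lambda_set q = {x mod (q\<^sup>2 - 1) | x a t :: int.
     t > 0 \<and> t dvd a\<^sup>2 + 1 \<and> coprime (a * q) t \<and>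
     real_of_int x =
       of_int ((q\<^sup>2 - 1) * a) / of_int t - of_int q * norm_dedekind_sum (a * q) t}"

definition Gamma_set :: "int \<Rightarrow> int set" where
  "Gamma_set q =
     (if is_square q
      then {(24 * s) mod (q\<^sup>2 - 1) | s. s \<in> carrier (residue_ring (q\<^sup>2 - 1))}
      else {(12 * s) mod (q\<^sup>2 - 1) | s. s \<in> carrier (residue_ring (q\<^sup>2 - 1))})"

end

theory Submission
  imports Defs
begin

text \<open>
  A matrix \<open>M\<close> in \<open>SL\<^sub>2(\<int>)\<close> with bottom row \<open>(q t, A)\<close> satisfies \<open>S(A, q t) = tr M / (q t) - \<Phi>(M)\<close>,
  where the Rademacher function \<open>\<Phi>\<close> is integer valued and additive up to a sign term.
  Left and right multiplication of \<open>M\<close> by suitable parabolic matrices, attached to a divisor \<open>d\<close>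
  of \<open>q\<close>, preserves \<open>tr M / (q t) = k / q\<close>, because it amounts to a unimodular change of variables
  in a positive definite form of determinant 1. The widths of the two parabolics are \<open>j\<close> and
  \<open>j d\<^sup>2\<close>, and positivity makes all sign terms cancel, so \<open>\<Phi>(M)\<close> changes by exactly \<open>j (1 - d\<^sup>2)\<close>.
  For \<open>d = 2, 3, 5\<close> the steps \<open>d\<^sup>2 - 1\<close> are \<open>3, 8, 24\<close>, which is just what the congruence
  obstructions modulo 3 and 8 leave free. The obstruction modulo 8 comes from Gauss's lemma:
  \<open>b S(a r\<^sup>2, b)\<close> is congruent to \<open>b S(a, b)\<close> modulo 8 for odd \<open>b\<close>.
\<close>

section \<open>Dedekind sums and the reciprocity law\<close>

lemma sawtooth_add_int [simp]: "sawtooth (x + of_int n) = sawtooth x"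
  by (auto simp: sawtooth_def frac_def)

lemma sawtooth_minus: "sawtooth (- x) = - sawtooth x"
  by (auto simp: sawtooth_def frac_neg)

lemma sawtooth_divide_mod:
  fixes b k :: int
  assumes "b > 0"
  shows "sawtooth (of_int (k mod b) / of_int b) = sawtooth (of_int k / of_int b)"
proof -
  have "real_of_int k = of_int (k mod b) + of_int b * of_int (k div b)"
    by (metis mod_mult_div_eq of_int_add of_int_mult)
  hence "of_int k / of_int b = (of_int (k mod b) / of_int b :: real) + of_int (k div b)"
    using assms by (simp add: field_simps)
  thus ?thesis by simp
qed

lemma sawtooth_divide_cong:
  fixes b k l :: int
  assumes "b > 0" "[k = l] (mod b)"
  shows "sawtooth (of_int k / of_int b) = sawtooth (of_int l / of_int b)"
  using sawtooth_divide_mod[of b k] sawtooth_divide_mod[of b l] assms by (simp add: cong_def)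

lemma sawtooth_divide:
  fixes b k :: int
  assumes "b > 0" "\<not> b dvd k"
  shows "sawtooth (of_int k / of_int b) = of_int (k mod b) / of_int b - 1 / 2"
proof -
  have "k mod b > 0" "k mod b < b" using assms
    by (simp_all add: dvd_eq_mod_eq_0 pos_mod_sign order_less_le[of 0])
  hence r: "0 < (of_int (k mod b) / of_int b :: real)" "(of_int (k mod b) / of_int b :: real) < 1"
    by auto
  hence "frac (of_int (k mod b) / of_int b :: real) = of_int (k mod b) / of_int b"
    by (simp add: frac_eq)
  moreover have "(of_int (k mod b) / of_int b :: real) \<notin> \<int>"
    using r by (metis calculation frac_eq_0_iff less_irrefl)
  ultimately show ?thesis using sawtooth_divide_mod[OF assms(1), of k] by (simp add: sawtooth_def)
qed

lemma bij_betw_mult_mod: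
  fixes b c :: int
  assumes "b > 0" "coprime c b"
  shows "bij_betw (\<lambda>k. c * k mod b) {0..<b} {0..<b}"
proof -
  have "inj_on (\<lambda>k. c * k mod b) {0..<b}"
  proof (rule inj_onI)
    fix k l assume kl: "k \<in> {0..<b}" "l \<in> {0..<b}" "c * k mod b = c * l mod b"
    hence "[k = l] (mod b)" using assms(2) by (metis cong_def cong_mult_lcancel)
    thus "k = l" using kl by (simp add: cong_def)
  qed
  moreover have "(\<lambda>k. c * k mod b) ` {0..<b} \<subseteq> {0..<b}" using assms by auto
  ultimately show ?thesis by (simp add: bij_betw_def endo_inj_surj)
qed

lemma dedekind_sum_alt:
  assumes "b > 0"
  shows "dedekind_sum a b =
    (\<Sum>k\<in>{0..<b}. sawtooth (of_int k / of_int b) * sawtooth (of_int (a * k) / of_int b))"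
proof -
  have [simp]: "sawtooth 0 = 0" "sawtooth 1 = 0" by (simp_all add: sawtooth_def)
  have 1: "{1..b} = insert b {1..<b}" "{0..<b} = insert 0 {1..<b}" using assms by auto
  show ?thesis unfolding dedekind_sum_def 1 using assms by simp
qed

lemma dedekind_sum_reindex:
  assumes "b > 0" "coprime c b"
  shows "dedekind_sum a b =
    (\<Sum>k\<in>{0..<b}. sawtooth (of_int (c * k) / of_int b) * sawtooth (of_int (a * c * k) / of_int b))"
proof -
  have "dedekind_sum a b = (\<Sum>k\<in>{0..<b}. sawtooth (of_int (c * k mod b) / of_int b) *
      sawtooth (of_int (a * (c * k mod b)) / of_int b))"
    unfolding dedekind_sum_alt[OF assms(1)]
    by (rule sum.reindex_bij_betw[OF bij_betw_mult_mod[OF assms], symmetric])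
  also have "\<dots> = (\<Sum>k\<in>{0..<b}. sawtooth (of_int (c * k) / of_int b) *
      sawtooth (of_int (a * c * k) / of_int b))"
    by (intro sum.cong refl arg_cong2[of _ _ _ _ "(*)"] sawtooth_divide_cong assms)
       (auto simp: cong_def mod_mult_right_eq mult.assoc)
  finally show ?thesis .
qed

lemma norm_dedekind_sum_cong:
  assumes "b > 0" "[a = a'] (mod b)"
  shows "norm_dedekind_sum a b = norm_dedekind_sum a' b"
  unfolding norm_dedekind_sum_def dedekind_sum_alt[OF assms(1)]
  by (intro arg_cong2[of _ _ _ _ "(*)"] sum.cong refl sawtooth_divide_cong assms cong_mult cong_refl)

lemma norm_dedekind_sum_minus:
  "norm_dedekind_sum (- a) b = - norm_dedekind_sum a b"
  by (simp add: norm_dedekind_sum_def dedekind_sum_def sawtooth_minus sum_negf)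

lemma norm_dedekind_sum_0_1: "norm_dedekind_sum 0 b = 0"
  by (simp add: norm_dedekind_sum_def dedekind_sum_def sawtooth_def)

text \<open>Replacing \<open>k\<close> by \<open>a * k\<close> exchanges the two sawtooth
  factors.\<close>

lemma norm_dedekind_sum_inverse:
  assumes "b > 0" "[a * a' = 1] (mod b)"
  shows "norm_dedekind_sum a' b = norm_dedekind_sum a b"
proof -
  have "coprime a b" using assms(2)
    by (meson coprime_iff_invertible_int)
  hence "dedekind_sum a' b = (\<Sum>k\<in>{0..<b}. sawtooth (of_int (a * k) / of_int b) *
      sawtooth (of_int (a' * a * k) / of_int b))"
    by (rule dedekind_sum_reindex[OF assms(1)])
  also have "\<dots> = (\<Sum>k\<in>{0..<b}. sawtooth (of_int (a * k) / of_int b) * sawtooth (of_int k / of_int b))"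
    using cong_mult[OF assms(2) cong_refl]
    by (intro arg_cong2[of _ _ _ _ "(*)"] sum.cong refl sawtooth_divide_cong assms)
       (simp add: mult.commute)
  finally show ?thesis
    by (simp add: norm_dedekind_sum_def dedekind_sum_alt[OF assms(1)] mult.commute)
qed

text \<open>\<open>- a\<close> inverts \<open>a\<close> modulo \<open>b\<close>, so invariance under
  inversion and oddness make the value its own negative.\<close>

lemma norm_dedekind_sum_eq_0:
  assumes "b > 0" "b dvd a\<^sup>2 + 1"
  shows "norm_dedekind_sum a b = 0"
proof -
  have "[a * (- a) = 1] (mod b)"
  proof -
    have "a * (- a) - 1 = - (a\<^sup>2 + 1)" by (simp add: power2_eq_square)
    thus ?thesis using assms(2) by (simp only: cong_iff_dvd_diff dvd_minus_iff)
  qed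
  from norm_dedekind_sum_inverse[OF assms(1) this] show ?thesis
    by (simp add: norm_dedekind_sum_minus)
qed

section \<open>Closed forms with remainders and with floors\<close>

lemma sum_ints: "b \<ge> 0 \<Longrightarrow> 2 * (\<Sum>k\<in>{0..<b}. k) = b * (b - 1)" for b :: int
proof (induction b rule: int_ge_induct)
  case (step b)
  have "{0..<b+1} = insert b {0..<b}" using step by auto
  thus ?case using step by (simp add: algebra_simps)
qed simp

lemma sum_ints_sq: "b \<ge> 0 \<Longrightarrow> 6 * (\<Sum>k\<in>{0..<b}. k\<^sup>2) = b * (b - 1) * (2 * b - 1)" for b :: int
proof (induction b rule: int_ge_induct)
  case (step b)
  have "{0..<b+1} = insert b {0..<b}" using step by auto
  thus ?case using step by (simp add: algebra_simps power2_eq_square)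
qed simp

lemma norm_dedekind_sum_formula:
  assumes "b > 0" "coprime a b"
  shows "of_int (b\<^sup>2) * norm_dedekind_sum a b =
    of_int (12 * (\<Sum>k\<in>{0..<b}. k * (a * k mod b)) - 3 * b\<^sup>2 * (b - 1))"
proof -
  \<comment> \<open>At \<open>k = 0\<close> both sawtooth values are 0, while the expanded product
    of \<open>- 1 / 2\<close> with itself is \<open>1 / 4\<close>; the last summand corrects this
    single term.\<close>
  have S: "sawtooth (of_int k / of_int b) * sawtooth (of_int (a * k) / of_int b) =
      of_int (k * (a * k mod b)) / (of_int b)\<^sup>2 - of_int k / (2 * of_int b)
      - of_int (a * k mod b) / (2 * of_int b) + (if k = 0 then 0 else 1 / 4)"
    if "k \<in> {0..<b}" for k
  proof (cases "k = 0")
    case False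
    hence "\<not> b dvd k" using that by (auto dest: zdvd_imp_le)
    moreover from this have "\<not> b dvd a * k" using assms(2)
      by (simp add: coprime_commute coprime_dvd_mult_right_iff)
    ultimately show ?thesis using that assms(1) False
      by (simp add: sawtooth_divide[of b k] sawtooth_divide[of b "a * k"] power2_eq_square
        field_simps del: of_int_mult) (simp add: field_simps)
  qed (simp add: sawtooth_def)
  have r: "(\<Sum>k\<in>{0..<b}. real_of_int (a * k mod b)) = (\<Sum>k\<in>{0..<b}. of_int k)"
    by (rule sum.reindex_bij_betw[OF bij_betw_mult_mod[OF assms]])
  have "real_of_int (2 * (\<Sum>k\<in>{0..<b}. k)) = of_int (b * (b - 1))"
    using sum_ints[of b] assms(1) by simp
  hence si: "(\<Sum>k\<in>{0..<b}. real_of_int k) = of_int b * (of_int b - 1) / 2" by simp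
  have c: "(\<Sum>k\<in>{0..<b}. if k = 0 then 0 else 1 / 4 :: real) = (of_int b - 1) / 4"
  proof -
    have "{0..<b} = insert 0 {1..<b}" using assms by auto
    moreover have "(\<Sum>k\<in>{1..<b}. if k = 0 then 0 else 1 / 4 :: real) = (\<Sum>k\<in>{1..<b}. 1 / 4)"
      by (intro sum.cong) auto
    ultimately show ?thesis using assms by simp
  qed
  have "dedekind_sum a b = (\<Sum>k\<in>{0..<b}. of_int (k * (a * k mod b)) / (of_int b)\<^sup>2
      - of_int k / (2 * of_int b) - of_int (a * k mod b) / (2 * of_int b)
      + (if k = 0 then 0 else 1 / 4))"
    unfolding dedekind_sum_alt[OF assms(1)] by (intro sum.cong refl S)
  also have "\<dots> = (\<Sum>k\<in>{0..<b}. of_int (k * (a * k mod b))) / (of_int b)\<^sup>2 - (of_int b - 1) / 4"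
    using si assms(1)
    by (simp add: sum.distrib sum_subtractf r c flip: sum_divide_distrib) (simp add: field_simps)
  finally show ?thesis using assms(1)
    by (simp add: norm_dedekind_sum_def field_simps power2_eq_square)
qed

lemma sum_residues:
  fixes a b :: int
  assumes "b > 0" "coprime a b"
  shows "(\<Sum>k\<in>{0..<b}. f (a * k mod b)) = (\<Sum>k\<in>{0..<b}. f k)"
  by (rule sum.reindex_bij_betw[OF bij_betw_mult_mod[OF assms]])

text \<open>Sum \<open>a * k = b * (a * k div b) + a * k mod b\<close> over a full residue system,
  which the remainders permute.\<close>

lemma sum_floors:
  fixes a b :: int
  assumes "b > 0" "coprime a b"
  shows "2 * (\<Sum>k\<in>{0..<b}. a * k div b) = (a - 1) * (b - 1)"
proof -
  have "a * (\<Sum>k\<in>{0..<b}. k) = (\<Sum>k\<in>{0..<b}. b * (a * k div b) + a * k mod b)"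
    by (simp add: sum_distrib_left)
  also have "\<dots> = (\<Sum>k\<in>{0..<b}. b * (a * k div b)) + (\<Sum>k\<in>{0..<b}. a * k mod b)"
    by (rule sum.distrib)
  also have "\<dots> = b * (\<Sum>k\<in>{0..<b}. a * k div b) + (\<Sum>k\<in>{0..<b}. k)"
    by (simp only: sum_residues[OF assms, of "\<lambda>k. k"] sum_distrib_left)
  finally have "b * (2 * (\<Sum>k\<in>{0..<b}. a * k div b)) = (a - 1) * (2 * (\<Sum>k\<in>{0..<b}. k))"
    by (simp add: algebra_simps)
  also have "\<dots> = b * ((a - 1) * (b - 1))"
    using sum_ints[of b] assms by simp
  finally show ?thesis using assms by simp
qed

text \<open>Trading remainders for floors cancels one factor \<open>b\<close> of
  \<open>norm_dedekind_sum_formula\<close>. Hence \<open>b * S(a, b)\<close> is an integer, and the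
  floor sum is open to lattice point counting.\<close>

lemma norm_dedekind_sum_floors:
  assumes "b > 0" "coprime a b"
  shows "of_int b * norm_dedekind_sum a b =
    of_int (2 * a * (b - 1) * (2 * b - 1) - 12 * (\<Sum>k\<in>{0..<b}. k * (a * k div b)) - 3 * b * (b - 1))"
proof -
  define X where "X = (\<Sum>k\<in>{0..<b}. k * (a * k div b))"
  have "(\<Sum>k\<in>{0..<b}. k * (a * k mod b)) = (\<Sum>k\<in>{0..<b}. a * k\<^sup>2 - b * (k * (a * k div b)))"
    by (intro sum.cong refl) (simp add: minus_div_mult_eq_mod[symmetric] algebra_simps power2_eq_square)
  also have "\<dots> = a * (\<Sum>k\<in>{0..<b}. k\<^sup>2) - b * X"
    by (simp add: X_def sum_subtractf sum_distrib_left)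
  finally have "12 * (\<Sum>k\<in>{0..<b}. k * (a * k mod b)) - 3 * b\<^sup>2 * (b - 1) =
      2 * a * (6 * (\<Sum>k\<in>{0..<b}. k\<^sup>2)) - 12 * b * X - 3 * b\<^sup>2 * (b - 1)"
    by simp
  also have "6 * (\<Sum>k\<in>{0..<b}. k\<^sup>2) = b * (b - 1) * (2 * b - 1)"
    using sum_ints_sq[of b] assms by simp
  also have "2 * a * (b * (b - 1) * (2 * b - 1)) - 12 * b * X - 3 * b\<^sup>2 * (b - 1) =
      b * (2 * a * (b - 1) * (2 * b - 1) - 12 * X - 3 * b * (b - 1))"
    by (simp add: algebra_simps power2_eq_square)
  finally have "of_int (b\<^sup>2) * norm_dedekind_sum a b = of_int b *
      of_int (2 * a * (b - 1) * (2 * b - 1) - 12 * X - 3 * b * (b - 1))"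
    using norm_dedekind_sum_formula[OF assms] by (simp only: of_int_mult)
  thus ?thesis using assms by (simp add: X_def power2_eq_square)
qed

section \<open>Reciprocity by counting lattice points\<close>

lemma sum_odds: "n \<ge> 0 \<Longrightarrow> (\<Sum>j\<in>{1..n}. 2 * j - 1) = n\<^sup>2" for n :: int
proof (induction n rule: int_ge_induct)
  case (step n)
  have "{1..n+1} = insert (n+1) {1..n}" using step by auto
  thus ?case using step by (simp add: algebra_simps power2_eq_square)
qed simp

text \<open>Counts the lattice points below the diagonal of an \<open>a \<times> b\<close> rectangle by columns and by rows.\<close>

lemma pos_le_div_iff_int: "b > 0 \<Longrightarrow> j \<le> n div b \<longleftrightarrow> b * j \<le> n" for b j n :: int
proof
  assume b: "b > 0"
  show "b * j \<le> n" if "j \<le> n div b"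
    using b mult_left_mono[OF that, of b] by (smt (verit) mult_div_mod_eq pos_mod_sign)
  show "j \<le> n div b" if "b * j \<le> n"
    using b zdiv_mono1[OF that b] by simp
qed

lemma sum_floors_sq:
  fixes a b :: int
  assumes "a > 0" "b > 0" "coprime a b"
  shows "(\<Sum>i\<in>{0..<b}. (a * i div b)\<^sup>2) = (\<Sum>j\<in>{1..<a}. (2 * j - 1) * (b - 1 - b * j div a))"
proof -
  have le_iff: "j \<le> a * i div b \<longleftrightarrow> \<not> i \<le> b * j div a" if "j \<in> {1..<a}" for i j
  proof -
    \<comment> \<open>Coprimality keeps these lattice points off the diagonal, so the two weak
      inequalities are complementary.\<close>
    have "\<not> a dvd j" using that by (auto dest: zdvd_imp_le)
    hence "a * i \<noteq> b * j" using assms(3)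
      by (metis coprime_dvd_mult_right_iff dvd_triv_left)
    moreover have "j \<le> a * i div b \<longleftrightarrow> b * j \<le> a * i"
      using assms(2) by (simp add: pos_le_div_iff_int)
    moreover have "i \<le> b * j div a \<longleftrightarrow> a * i \<le> b * j"
      using assms(1) by (simp add: pos_le_div_iff_int)
    ultimately show ?thesis by linarith
  qed
  have "(\<Sum>i\<in>{0..<b}. (a * i div b)\<^sup>2) = (\<Sum>i\<in>{0..<b}. \<Sum>j\<in>{1..<a}. if j \<le> a * i div b then 2 * j - 1 else 0)"
  proof (intro sum.cong refl)
    fix i assume i: "i \<in> {0..<b}"
    have 0: "0 \<le> a * i div b" using i assms by (simp add: pos_imp_zdiv_nonneg_iff)
    have "a * i < a * b" using i assms by simp
    hence "a * i div b < a" using assms by (simp add: pos_le_div_iff_int flip: not_le)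
    hence "{1..a * i div b} = {1..<a} \<inter> {j. j \<le> a * i div b}" by auto
    thus "(a * i div b)\<^sup>2 = (\<Sum>j\<in>{1..<a}. if j \<le> a * i div b then 2 * j - 1 else 0)"
      using sum_odds[OF 0] by (simp add: sum.If_cases)
  qed
  also have "\<dots> = (\<Sum>j\<in>{1..<a}. \<Sum>i\<in>{0..<b}. if j \<le> a * i div b then 2 * j - 1 else 0)"
    by (rule sum.swap)
  also have "\<dots> = (\<Sum>j\<in>{1..<a}. (2 * j - 1) * (b - 1 - b * j div a))"
  proof (intro sum.cong refl)
    fix j assume j: "j \<in> {1..<a}"
    have 0: "0 \<le> b * j div a" using j assms by (simp add: pos_imp_zdiv_nonneg_iff)
    have "b * j < b * a" using j assms by simp
    hence "b * j div a < b" using assms by (simp add: pos_le_div_iff_int flip: not_le)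
    hence e: "{0..<b} \<inter> {i. \<not> i \<le> b * j div a} = {b * j div a<..<b}" using 0 by auto
    have "(\<Sum>i\<in>{0..<b}. if j \<le> a * i div b then 2 * j - 1 else 0) =
        (\<Sum>i\<in>{0..<b}. if \<not> i \<le> b * j div a then 2 * j - 1 else 0)"
      by (simp only: le_iff[OF j])
    also have "\<dots> = (2 * j - 1) * (b - 1 - b * j div a)"
      using e \<open>b * j div a < b\<close> by (simp add: sum.If_cases del: not_le)
    finally show "(\<Sum>i\<in>{0..<b}. if j \<le> a * i div b then 2 * j - 1 else 0) =
        (2 * j - 1) * (b - 1 - b * j div a)" .
  qed
  finally show ?thesis .
qed

text \<open>The remainders \<open>a * k mod b\<close> permute \<open>{0..<b}\<close>, so their
  squares again sum to \<open>Q\<close>; expanding expresses \<open>X\<close> through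
  \<open>Z\<close>. The lattice point count expresses \<open>Z\<close> through \<open>Y\<close>.
  Together they give the relation between the floor sums \<open>X\<close> and \<open>Y\<close> that
  is needed.\<close>

theorem dedekind_reciprocity:
  assumes "a > 0" "b > 0" "coprime a b"
  shows "norm_dedekind_sum a b + norm_dedekind_sum b a =
    (of_int a)\<^sup>2 / of_int (a * b) + (of_int b)\<^sup>2 / of_int (a * b) + 1 / of_int (a * b) - 3"
proof -
  define X where "X = (\<Sum>k\<in>{0..<b}. k * (a * k div b))"
  define Y where "Y = (\<Sum>k\<in>{0..<a}. k * (b * k div a))"
  define Z where "Z = (\<Sum>k\<in>{0..<b}. (a * k div b)\<^sup>2)"
  define Q where "Q = (\<Sum>k\<in>{0..<b}. k\<^sup>2)"
  have a0: "{0..<a} = insert 0 {1..<a}" using assms by auto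
  \<comment> \<open>The range is extended by \<open>j = 0\<close>, whose term is
    \<open>- (b - 1)\<close>; the summand \<open>b - 1\<close> compensates.\<close>
  have "Z = (\<Sum>j\<in>{0..<a}. (2 * j - 1) * (b - 1 - b * j div a)) + (b - 1)"
    using sum_floors_sq[OF assms] by (simp add: Z_def a0)
  also have "(\<Sum>j\<in>{0..<a}. (2 * j - 1) * (b - 1 - b * j div a)) =
      (\<Sum>j\<in>{0..<a}. (b - 1) * (2 * j) - (b - 1) - 2 * (j * (b * j div a)) + b * j div a)"
    by (intro sum.cong refl) (simp add: algebra_simps)
  also have "\<dots> = (b - 1) * (2 * (\<Sum>j\<in>{0..<a}. j)) - a * (b - 1) - 2 * Y + (\<Sum>j\<in>{0..<a}. b * j div a)"
    using assms(1) by (simp add: Y_def sum.distrib sum_subtractf sum_distrib_left)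
  finally have Z: "2 * Z = 2 * (b - 1) * (a * (a - 1)) - 2 * a * (b - 1) - 4 * Y + (b - 1) * (a - 1) + 2 * (b - 1)"
    using sum_ints[of a] sum_floors[of a b] assms by (simp add: coprime_commute algebra_simps)
  have "Q = (\<Sum>k\<in>{0..<b}. (a * k mod b)\<^sup>2)"
    using sum_residues[OF assms(2,3), of "\<lambda>k. k\<^sup>2"] by (simp add: Q_def)
  also have "\<dots> = (\<Sum>k\<in>{0..<b}. a\<^sup>2 * k\<^sup>2 - 2 * a * b * (k * (a * k div b)) + b\<^sup>2 * (a * k div b)\<^sup>2)"
    by (intro sum.cong refl)
       (simp add: minus_div_mult_eq_mod[symmetric] algebra_simps power2_eq_square)
  also have "\<dots> = a\<^sup>2 * Q - 2 * a * b * X + b\<^sup>2 * Z"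
    by (simp add: Q_def X_def Z_def sum.distrib sum_subtractf sum_distrib_left)
  finally have "b * (12 * a * X) = (a\<^sup>2 - 1) * (6 * Q) + 3 * b\<^sup>2 * (2 * Z)"
    by (simp add: algebra_simps)
  also have "6 * Q = b * (b - 1) * (2 * b - 1)" using sum_ints_sq[of b] assms by (simp add: Q_def)
  finally have "b * (12 * a * X) = b * ((a\<^sup>2 - 1) * ((b - 1) * (2 * b - 1)) + 3 * b * (2 * Z))"
    by (simp add: algebra_simps power2_eq_square)
  hence X: "12 * a * X = (a\<^sup>2 - 1) * ((b - 1) * (2 * b - 1)) + 3 * b * (2 * Z)"
    using assms(2) by simp
  have "of_int a * (of_int b * norm_dedekind_sum a b) + of_int b * (of_int a * norm_dedekind_sum b a) =
      of_int (a * (2 * a * (b - 1) * (2 * b - 1) - 12 * X - 3 * b * (b - 1)) +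
              b * (2 * b * (a - 1) * (2 * a - 1) - 12 * Y - 3 * a * (a - 1)))"
    using norm_dedekind_sum_floors[of b a] norm_dedekind_sum_floors[of a b] assms
    by (simp add: X_def Y_def coprime_commute)
  also have "a * (2 * a * (b - 1) * (2 * b - 1) - 12 * X - 3 * b * (b - 1)) +
              b * (2 * b * (a - 1) * (2 * a - 1) - 12 * Y - 3 * a * (a - 1)) = a\<^sup>2 + b\<^sup>2 + 1 - 3 * a * b"
    using X unfolding Z by (simp add: algebra_simps power2_eq_square)
  finally show ?thesis using assms(1,2) by (simp add: field_simps power2_eq_square)
qed

section \<open>The Rademacher function\<close>

text \<open>Rademacher's function \<Phi> of the matrix \<open>[a, b; c, d]\<close>. For
  \<open>c = 0\<close> and determinant 1, \<open>d\<close> is 1 or -1, so \<open>b * d\<close> is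
  the usual \<open>b / d\<close>.\<close>

definition rademacher :: "int \<Rightarrow> int \<Rightarrow> int \<Rightarrow> int \<Rightarrow> real" where
  "rademacher a b c d =
     (if c = 0 then of_int (b * d)
      else of_int (a + d) / of_int c - of_int (sgn c) * norm_dedekind_sum d \<bar>c\<bar>)"

lemma det_eq_1_cases:
  fixes a d :: int
  assumes "a * d = 1"
  obtains "a = 1" "d = 1" | "a = -1" "d = -1"
  using assms by (auto simp: zmult_eq_1_iff)

text \<open>Right multiplication by \<open>[1, n; 0, 1]\<close> adds \<open>n * c\<close> to the
  trace and keeps \<open>d\<close> fixed modulo \<open>c\<close>.\<close>

lemma rademacher_translate:
  assumes "a * d - b * c = 1"
  shows "rademacher a (b + n * a) c (d + n * c) = rademacher a b c d + of_int n"
proof (cases "c = 0")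
  case True
  hence "a * d = 1" using assms by simp
  thus ?thesis using True by (cases rule: det_eq_1_cases) (auto simp: rademacher_def algebra_simps)
next
  case False
  have "[d + n * c = d] (mod \<bar>c\<bar>)" by (simp add: cong_iff_dvd_diff)
  hence "norm_dedekind_sum (d + n * c) \<bar>c\<bar> = norm_dedekind_sum d \<bar>c\<bar>"
    using False by (intro norm_dedekind_sum_cong) auto
  thus ?thesis using False by (simp add: rademacher_def field_simps)
qed

lemma norm_dedekind_sum_abs: "norm_dedekind_sum \<bar>a\<bar> b = of_int (sgn a) * norm_dedekind_sum a b"
  by (cases a "0 :: int" rule: linorder_cases)
     (auto simp: norm_dedekind_sum_minus norm_dedekind_sum_0_1)

lemma dedekind_reciprocity_signed:
  assumes "c \<noteq> 0" "d \<noteq> 0" "coprime c d"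
  shows "of_int (sgn c) * norm_dedekind_sum d \<bar>c\<bar> + of_int (sgn d) * norm_dedekind_sum c \<bar>d\<bar> =
    of_int c / of_int d + of_int d / of_int c + 1 / of_int (c * d) - 3 * of_int (sgn (c * d))"
proof -
  have sq: "x\<^sup>2 / (x * y) = x / y" and sq': "x\<^sup>2 / (y * x) = x / y" if "x \<noteq> 0" for x y :: real
    using that by (simp_all add: power2_eq_square)
  have "norm_dedekind_sum \<bar>d\<bar> \<bar>c\<bar> + norm_dedekind_sum \<bar>c\<bar> \<bar>d\<bar> =
    (of_int \<bar>d\<bar>)\<^sup>2 / of_int (\<bar>d\<bar> * \<bar>c\<bar>) + (of_int \<bar>c\<bar>)\<^sup>2 / of_int (\<bar>d\<bar> * \<bar>c\<bar>) +
    1 / of_int (\<bar>d\<bar> * \<bar>c\<bar>) - 3"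
    using assms by (intro dedekind_reciprocity) (auto simp: coprime_commute)
  hence "of_int (sgn d) * norm_dedekind_sum d \<bar>c\<bar> + of_int (sgn c) * norm_dedekind_sum c \<bar>d\<bar> =
    of_int \<bar>d\<bar> / of_int \<bar>c\<bar> + of_int \<bar>c\<bar> / of_int \<bar>d\<bar> + 1 / (of_int \<bar>d\<bar> * of_int \<bar>c\<bar>) - 3"
    using assms(1,2) unfolding norm_dedekind_sum_abs of_int_mult
    by (simp only: sq sq' of_int_eq_0_iff abs_eq_0 not_False_eq_True)
  thus ?thesis using assms(1,2)
    by (cases c "0 :: int" rule: linorder_cases; cases d "0 :: int" rule: linorder_cases)
       (auto simp: sgn_mult mult.commute)
qed

text \<open>Reciprocity in matrix form: right multiplication by \<open>[0, -1; 1, 0]\<close> turns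
  the sum modulo \<open>c\<close> into one modulo \<open>d\<close>.\<close>

lemma rademacher_invert:
  assumes "a * d - b * c = 1"
  shows "rademacher b (- a) d (- c) = rademacher a b c d - 3 * of_int (sgn (c * d))"
proof (cases "c = 0 \<or> d = 0")
  case True
  thus ?thesis
  proof
    assume c: "c = 0"
    hence "a * d = 1" using assms by simp
    thus ?thesis using c
      by (cases rule: det_eq_1_cases) (auto simp: rademacher_def norm_dedekind_sum_0_1)
  next
    assume d: "d = 0"
    hence "(- b) * c = 1" using assms by simp
    thus ?thesis using d
      by (cases rule: det_eq_1_cases) (auto simp: rademacher_def norm_dedekind_sum_0_1)
  qed
next
  case False
  have "coprime c d"
    by (rule coprimeI) (metis assms dvd_diff dvd_mult mult.commute)
  moreover have "of_int a * of_int d - of_int b * of_int c = (1 :: real)"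
    using assms by (metis of_int_1 of_int_diff of_int_mult)
  hence "of_int (b + - c) / of_int d - of_int (a + d) / of_int c +
      (of_int c / of_int d + of_int d / of_int c + 1 / of_int (c * d)) = (0 :: real)"
    using False by (simp add: field_simps)
  ultimately show ?thesis using False dedekind_reciprocity_signed[of c d]
    by (simp add: rademacher_def norm_dedekind_sum_minus)
qed

lemma rademacher_minus: "rademacher (- a) (- b) (- c) (- d) = rademacher a b c d"
  by (auto simp: rademacher_def norm_dedekind_sum_minus field_simps)

text \<open>
  The cocycle relation for the sign term of \<open>rademacher_mult\<close> when the second factor is
  extended by \<open>[0, -1; 1, 0]\<close>.
\<close>

lemma sgn_exchange:
  fixes p r u v :: int
  assumes "u \<noteq> 0 \<or> v \<noteq> 0" "p \<noteq> 0 \<or> r \<noteq> 0"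
  shows "sgn ((p * v - r * u) * u * p) + sgn (p * r) = sgn (u * v) + sgn ((p * v - r * u) * v * r)"
proof (cases "p = 0 \<or> r = 0 \<or> u = 0 \<or> v = 0")
  case True
  thus ?thesis using assms by (auto simp: sgn_mult)
next
  case False
  \<comment> \<open>The sign of \<open>p * v - r * u\<close> matters only when \<open>u * p\<close>
    and \<open>v * r\<close> have opposite signs. Then \<open>p * v\<close> and
    \<open>- (r * u)\<close> have equal signs, which determines it.\<close>
  have "sgn (x + y) = sgn x" if "sgn x = sgn y" for x y :: int
    using that by (auto simp: sgn_if split: if_splits)
  from this[of "p * v" "- (r * u)"]
  have "sgn p * sgn v = - (sgn r * sgn u) \<Longrightarrow> sgn (p * v - r * u) = sgn p * sgn v"
    by (simp add: sgn_mult)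
  thus ?thesis using False
    by (cases p "0 :: int" rule: linorder_cases; cases r "0 :: int" rule: linorder_cases;
        cases u "0 :: int" rule: linorder_cases; cases v "0 :: int" rule: linorder_cases)
       (simp_all add: sgn_mult)
qed

text \<open>Rademacher's composition law, by the Euclidean algorithm on the bottom row of the second
  factor: translations and \<open>[0, -1; 1, 0]\<close> are split off until it is upper triangular,
  and \<open>sgn_exchange\<close> matches the sign terms of each round.\<close>

theorem rademacher_mult:
  assumes "a * d - b * c = 1" "a' * d' - b' * c' = 1"
  shows "rademacher (a * a' + b * c') (a * b' + b * d') (c * a' + d * c') (c * b' + d * d') =
    rademacher a b c d + rademacher a' b' c' d' - 3 * of_int (sgn (c * c' * (c * a' + d * c')))"
  using assms(2)
proof (induction "nat \<bar>c'\<bar>" arbitrary: a' b' c' d' rule: less_induct)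
  case less
  show ?case
  proof (cases "c' = 0")
    case True
    hence "a' * d' = 1" using less.prems by simp
    thus ?thesis
    proof (cases rule: det_eq_1_cases)
      case 1
      thus ?thesis using True rademacher_translate[OF assms(1), of b']
        by (simp add: mult.commute add.commute) (simp add: rademacher_def)
    next
      case 2
      thus ?thesis using True rademacher_translate[OF assms(1), of "- b'"]
          rademacher_minus[of a "b - b' * a" c "d - b' * c"]
        by (simp add: mult.commute add.commute) (simp add: rademacher_def)
    qed
  next
    case False
    \<comment> \<open>The second factor is \<open>[a', b0; c', v]\<close> times
      \<open>[1, n; 0, 1]\<close>, and \<open>[a', b0; c', v]\<close> is
      \<open>[- b0, a'; - v, c']\<close> times \<open>[0, -1; 1, 0]\<close>. The new lower left
      entry \<open>- v\<close> is smaller than \<open>c'\<close> in absolute value.\<close>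
    define n where "n = d' div c'"
    define v where "v = d' mod c'"
    define b0 where "b0 = b' - n * a'"
    have d': "d' = v + n * c'" by (simp add: v_def n_def)
    have b': "b' = b0 + n * a'" by (simp add: b0_def)
    have det: "a' * v - b0 * c' = 1" using less.prems by (simp add: d' b' algebra_simps)
    have det1: "(- b0) * c' - a' * (- v) = 1" using det by simp
    have small: "nat \<bar>- v\<bar> < nat \<bar>c'\<bar>" using False by (simp add: v_def abs_mod_less)
    define p where "p = c * a' + d * c'"
    define r where "r = c * b0 + d * v"
    have detp: "(a * a' + b * c') * r - (a * b0 + b * v) * p = 1"
    proof -
      have "(a * a' + b * c') * r - (a * b0 + b * v) * p = (a * d - b * c) * (a' * v - b0 * c')"
        by (simp add: p_def r_def algebra_simps)
      thus ?thesis using assms(1) det by simp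
    qed
    have detr: "(a * (- b0) + b * (- v)) * p - (a * a' + b * c') * (- r) = 1"
      using detp by (simp add: algebra_simps)
    \<comment> \<open>Cramer's rule recovers \<open>c\<close> from \<open>(p, r)\<close>, the bottom
      row of the first factor times \<open>[a', b0; c', v]\<close>; this is the determinant
      occurring in \<open>sgn_exchange\<close>.\<close>
    have c: "c = p * v - r * c'"
    proof -
      have "p * v - r * c' = c * (a' * v - b0 * c')" by (simp add: p_def r_def algebra_simps)
      thus ?thesis using det by simp
    qed
    have pr: "p \<noteq> 0 \<or> r \<noteq> 0" using detp by auto
    have IH: "rademacher (a * (- b0) + b * (- v)) (a * a' + b * c') (- r) p =
        rademacher a b c d + rademacher (- b0) a' (- v) c' - 3 * of_int (sgn (c * (- v) * (- r)))"
      using less.hyps[OF small det1] by (simp add: p_def r_def algebra_simps)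
    have "rademacher (a * a' + b * c') (a * b' + b * d') p (c * b' + d * d') =
        rademacher (a * a' + b * c') (a * b0 + b * v) p r + of_int n"
      using rademacher_translate[OF detp, of n] by (simp add: b' d' p_def r_def algebra_simps)
    also have "rademacher (a * a' + b * c') (a * b0 + b * v) p r =
        rademacher (a * (- b0) + b * (- v)) (a * a' + b * c') (- r) p - 3 * of_int (sgn ((- r) * p))"
      using rademacher_invert[OF detr] by (simp add: algebra_simps)
    also have "\<dots> = rademacher a b c d + rademacher (- b0) a' (- v) c'
        - 3 * of_int (sgn (c * v * r) - sgn (r * p))"
      unfolding IH by simp
    also have "rademacher (- b0) a' (- v) c' = rademacher a' b0 c' v - 3 * of_int (sgn (v * c'))"
      using rademacher_invert[OF det1] by simp
    also have "rademacher a' b0 c' v = rademacher a' b' c' d' - of_int n"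
      using rademacher_translate[OF det, of n] by (simp add: b' d')
    finally have "rademacher (a * a' + b * c') (a * b' + b * d') p (c * b' + d * d') =
        rademacher a b c d + rademacher a' b' c' d'
        - 3 * of_int (sgn (c * v * r) + sgn (c' * v) - sgn (p * r))"
      by (simp add: mult.commute)
    also have "sgn (c * v * r) + sgn (c' * v) - sgn (p * r) = sgn (c * c' * p)"
      using sgn_exchange[of c' v p r] False pr c by simp
    finally show ?thesis by (simp add: p_def)
  qed
qed

text \<open>The same Euclidean descent: each round changes the value by an integer, and the value at
  \<open>c = 0\<close> is an integer.\<close>

lemma rademacher_in_Ints:
  assumes "a * d - b * c = 1"
  shows "rademacher a b c d \<in> \<int>"
  using assms
proof (induction "nat \<bar>c\<bar>" arbitrary: a b c d rule: less_induct)
  case less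
  show ?case
  proof (cases "c = 0")
    case True
    thus ?thesis by (simp add: rademacher_def)
  next
    case False
    define n where "n = d div c"
    define v where "v = d mod c"
    define b0 where "b0 = b - n * a"
    have d: "d = v + n * c" by (simp add: v_def n_def)
    have b: "b = b0 + n * a" by (simp add: b0_def)
    have det: "a * v - b0 * c = 1" using less.prems by (simp add: d b algebra_simps)
    hence det1: "(- b0) * c - a * (- v) = 1" by simp
    have "nat \<bar>- v\<bar> < nat \<bar>c\<bar>" using False by (simp add: v_def abs_mod_less)
    from less.hyps[OF this det1] have "rademacher a b0 c v \<in> \<int>"
      using rademacher_invert[OF det1] by simp
    thus ?thesis using rademacher_translate[OF det, of n] by (simp add: b d)
  qed
qed

text \<open>The sign terms of the two multiplications are \<open>sgn p\<close> and
  \<open>- sgn p\<close>, where \<open>p\<close> is the lower left entry of the product of the first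
  two factors. They cancel whatever the sign of \<open>p\<close> is.\<close>

lemma rademacher_sandwich:
  assumes "a * d - b * c = 1" "a' * d' - b' * c' = 1"
    and "c > 0" "c' > 0" "w < 0"
    and "(c * a' + d * c') + (c * b' + d * d') * w > 0"
  shows "rademacher (a * a' + b * c' + (a * b' + b * d') * w) (a * b' + b * d')
      (c * a' + d * c' + (c * b' + d * d') * w) (c * b' + d * d') =
    rademacher a b c d + rademacher a' b' c' d' + rademacher 1 0 w 1"
proof -
  define p where "p = c * a' + d * c'"
  have det: "(a * a' + b * c') * (c * b' + d * d') - (a * b' + b * d') * p = 1"
  proof -
    have "(a * a' + b * c') * (c * b' + d * d') - (a * b' + b * d') * p =
        (a * d - b * c) * (a' * d' - b' * c')"
      by (simp add: p_def algebra_simps)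
    thus ?thesis using assms by simp
  qed
  have 1: "(1::int) * 1 - 0 * w = 1" by simp
  have "sgn (p * w * (p + (c * b' + d * d') * w)) = - sgn p" "sgn (c * c' * p) = sgn p"
    using assms(3-6) by (simp_all add: sgn_mult p_def)
  thus ?thesis using rademacher_mult[OF det 1] rademacher_mult[OF assms(1,2)]
    by (simp add: p_def)
qed

section \<open>Parabolic steps\<close>

lemma rademacher_left_translate:
  assumes "a * d - b * c = 1"
  shows "rademacher (a + n * c) (b + n * d) c d = rademacher a b c d + of_int n"
proof (cases "c = 0")
  case True
  hence "a * d = 1" using assms by simp
  thus ?thesis using True by (cases rule: det_eq_1_cases) (auto simp: rademacher_def)
qed (simp add: rademacher_def field_simps)

text \<open>
  The matrix is \<open>P T\<^sup>j P\<^sup>-\<^sup>1 M R\<^sup>-\<^sup>1 T\<^sup>-\<^sup>l R\<close> with \<open>T = [1, 1; 0, 1]\<close>, where \<open>P\<close> has first column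
  \<open>(u, v)\<close> and \<open>R = [1, 0; -w, 1]\<close>. The two sign terms of \<open>P N R\<close>, \<open>N = P\<^sup>-\<^sup>1 M R\<^sup>-\<^sup>1\<close>, cancel by
  positivity, and the powers of \<open>T\<close> are absorbed into \<open>N\<close>.
\<close>

lemma rademacher_parabolic:
  fixes a b c d u v w j l :: int
  assumes det: "a * d - b * c = 1" and pos: "c > 0" "v > 0" "w > 0" and cop: "coprime u v"
    and n: "u * (c + d * w) - v * (a + b * w) > 0"
  defines "x \<equiv> u * c - v * a" and "z \<equiv> u * d - v * b"
  assumes pos': "(c + j * v * x) * (1 + l * w) + (d + j * v * z) * (l * w\<^sup>2) > 0"
  shows "rademacher
      ((a + j * u * x) * (1 + l * w) + (b + j * u * z) * (l * w\<^sup>2))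
      ((b + j * u * z) * (1 - l * w) - (a + j * u * x) * l)
      ((c + j * v * x) * (1 + l * w) + (d + j * v * z) * (l * w\<^sup>2))
      ((d + j * v * z) * (1 - l * w) - (c + j * v * x) * l) =
    rademacher a b c d + of_int (j - l)" (is "rademacher ?a' ?b' ?c' ?d' = _")
proof -
  \<comment> \<open>Completes the column \<open>(u, v)\<close> to
    \<open>P = [u, f; v, e]\<close>.\<close>
  obtain e f where ef: "u * e - f * v = 1"
  proof -
    from cop obtain e f where "u * e + v * f = 1"
      by (metis bezout_int coprime_imp_gcd_eq_1 mult.commute)
    thus ?thesis using that[of e "- f"] by (simp add: mult.commute)
  qed
  \<comment> \<open>\<open>N\<close> is \<open>[n1, n2; n3, z]\<close>; the facts \<open>h1\<close>
    to \<open>h4\<close> below say that \<open>P\<close> times \<open>N\<close> is \<open>M\<close>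
    times the inverse of \<open>R\<close>.\<close>
  define n1 where "n1 = e * (a + b * w) - f * (c + d * w)"
  define n2 where "n2 = e * b - f * d"
  define n3 where "n3 = x + z * w"
  have n3: "n3 > 0" using n by (simp add: n3_def x_def z_def algebra_simps)
  have cancel: "(u * e - f * v) * h = h" for h using ef by simp
  have detN: "n1 * z - n2 * n3 = 1"
  proof -
    have "n1 * z - n2 * n3 = (u * e - f * v) * (a * d - b * c)"
      by (simp add: n1_def n2_def n3_def x_def z_def algebra_simps)
    thus ?thesis using det ef by simp
  qed
  have h1: "u * n1 + f * n3 = a + b * w"
    using cancel[of "a + b * w"] by (simp add: n1_def n3_def x_def z_def algebra_simps)
  have h2: "u * n2 + f * z = b"
    using cancel[of b] by (simp add: n2_def z_def algebra_simps)
  have h3: "v * n1 + e * n3 = c + d * w"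
    using cancel[of "c + d * w"] by (simp add: n1_def n3_def x_def z_def algebra_simps)
  have h4: "v * n2 + e * z = d"
    using cancel[of d] by (simp add: n2_def z_def algebra_simps)
  have old: "rademacher a b c d = rademacher u f v e + rademacher n1 n2 n3 z + rademacher 1 0 (- w) 1"
    using rademacher_sandwich[OF ef detN pos(2) n3, of "- w"] pos unfolding h1 h2 h3 h4 by simp
  \<comment> \<open>The primed entries are those of \<open>T\<^sup>j N T\<^sup>-\<^sup>l\<close>.
    Its lower left entry is still \<open>n3\<close>, so the same positivity serves the old and the
    new product.\<close>
  define n1' where "n1' = n1 + j * n3"
  define n2' where "n2' = n2 + j * z - l * n1'"
  define n4' where "n4' = z - l * n3"
  have detT: "n1' * z - (n2 + j * z) * n3 = 1"
    using detN by (simp add: n1'_def algebra_simps)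
  have detN': "n1' * n4' - n2' * n3 = 1"
    using detT by (simp add: n2'_def n4'_def algebra_simps)
  have radN': "rademacher n1' n2' n3 n4' = rademacher n1 n2 n3 z + of_int (j - l)"
    using rademacher_left_translate[OF detN, of j] rademacher_translate[OF detT, of "- l"]
    by (simp add: n1'_def n2'_def n4'_def)
  have g1: "u * n1' + f * n3 = a + b * w + j * u * n3"
    unfolding h1[symmetric] by (simp add: n1'_def algebra_simps)
  have g2: "u * n2' + f * n4' = ?b'"
  proof -
    have "u * n2' + f * n4' = (u * n2 + f * z) + j * u * z - l * (u * n1' + f * n3)"
      by (simp add: n2'_def n4'_def algebra_simps)
    thus ?thesis unfolding h2 g1 by (simp add: n3_def algebra_simps)
  qed
  have g3: "v * n1' + e * n3 = c + d * w + j * v * n3"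
    unfolding h3[symmetric] by (simp add: n1'_def algebra_simps)
  have g4: "v * n2' + e * n4' = ?d'"
  proof -
    have "v * n2' + e * n4' = (v * n2 + e * z) + j * v * z - l * (v * n1' + e * n3)"
      by (simp add: n2'_def n4'_def algebra_simps)
    thus ?thesis unfolding h4 g3 by (simp add: n3_def algebra_simps)
  qed
  have a': "a + b * w + j * u * n3 + ?b' * (- w) = ?a'"
    by (simp add: n3_def algebra_simps power2_eq_square)
  have c': "c + d * w + j * v * n3 + ?d' * (- w) = ?c'"
    by (simp add: n3_def algebra_simps power2_eq_square)
  have "rademacher ?a' ?b' ?c' ?d' =
      rademacher u f v e + rademacher n1' n2' n3 n4' + rademacher 1 0 (- w) 1"
    using rademacher_sandwich[OF ef detN' pos(2) n3, of "- w"] pos(3) pos'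
    unfolding g1 g2 g3 g4 a' c' by simp
  thus ?thesis unfolding old radN' by simp
qed

section \<open>Forms of determinant 1 and the levels of a value\<close>

lemma pos_def_form:
  fixes t A t' X Y :: int
  assumes "t > 0" "t * t' = A\<^sup>2 + 1" "X \<noteq> 0 \<or> Y \<noteq> 0"
  shows "t * X\<^sup>2 + 2 * A * X * Y + t' * Y\<^sup>2 > 0"
proof -
  have "t * (t * X\<^sup>2 + 2 * A * X * Y + t' * Y\<^sup>2) = (t * X + A * Y)\<^sup>2 + (t * t' - A\<^sup>2) * Y\<^sup>2"
    by (simp add: algebra_simps power2_eq_square)
  also have "\<dots> = (t * X + A * Y)\<^sup>2 + Y\<^sup>2" using assms(2) by simp
  also have "\<dots> > 0" using assms(1,3) by (cases "Y = 0") (auto intro: add_nonneg_pos)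
  finally show ?thesis using assms(1) by (simp add: zero_less_mult_iff)
qed

text \<open>
  The condition means \<open>S(A, q t) = k / q - n\<close>. With \<open>\<gamma> = k A - q \<beta>\<close>, the matrix is \<open>[k, -1; q, 0]\<close>
  times the positive definite matrix \<open>[t, A; A, \<gamma>]\<close> of determinant 1 times \<open>diag(1, 1/q)\<close>, and
  the parabolic steps act as changes of variables in that form.
\<close>

definition dedekind_level :: "int \<Rightarrow> int \<Rightarrow> int \<Rightarrow> bool" where
  "dedekind_level q k n \<longleftrightarrow> (\<exists>t A \<beta>. t > 0 \<and> (k * t - A) * A - \<beta> * (q * t) = 1 \<and>
     rademacher (k * t - A) \<beta> (q * t) A = of_int n)"

text \<open>Let \<open>U\<close> be the identity plus \<open>j * q\<close> times the column
  \<open>(y, - d)\<close> times the row \<open>(d, y)\<close>. In the coordinates of the form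
  \<open>[t, A; A, \<gamma>]\<close> the left parabolic acts as \<open>U\<close> and the right one
  as its transpose, so the form stays symmetric with determinant 1. The level changes by the
  difference of the widths.\<close>

lemma dedekind_level_step:
  fixes q k n d m y j :: int
  assumes "dedekind_level q k n" and q: "q = d * m" and pos: "d > 0" "m > 0" "y > 0"
    and cop: "coprime (d + k * y) (q * y)"
  shows "dedekind_level q k (n + j * (1 - d\<^sup>2))"
proof -
  obtain t A \<beta> where t: "t > 0" and det: "(k * t - A) * A - \<beta> * (q * t) = 1"
    and rad: "rademacher (k * t - A) \<beta> (q * t) A = of_int n"
    using assms(1) by (auto simp: dedekind_level_def)
  define \<gamma> where "\<gamma> = k * A - q * \<beta>"
  have \<gamma>: "t * \<gamma> = A\<^sup>2 + 1" using det by (simp add: \<gamma>_def algebra_simps power2_eq_square)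
  \<comment> \<open>\<open>(u, v)\<close> is the image of \<open>(y, - d)\<close> under
    \<open>[k, -1; q, 0]\<close>, and \<open>diag(1, 1/q)\<close> sends \<open>(1, w)\<close> to a
    multiple of \<open>(d, y)\<close>. The width \<open>l = j * d\<^sup>2\<close> is what makes the
    right action the transpose of the left one. The first row of \<open>U\<close> is
    \<open>(X, Y)\<close>, so \<open>t'\<close> is the new corner of the form.\<close>
  define u v w l where "u = d + k * y" and "v = q * y" and "w = m * y" and "l = j * d\<^sup>2"
  define X where "X = 1 + j * d * v"
  define Y where "Y = j * v * y"
  define t' where "t' = t * X\<^sup>2 + 2 * A * X * Y + \<gamma> * Y\<^sup>2"
  have "X \<noteq> 0 \<or> Y \<noteq> 0"
  proof (rule ccontr)
    assume "\<not> (X \<noteq> 0 \<or> Y \<noteq> 0)"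
    moreover from this have "j * v = 0" using pos by (auto simp: Y_def)
    ultimately show False by (auto simp: X_def)
  qed
  hence t': "t' > 0" unfolding t'_def by (intro pos_def_form t \<gamma>)
  have qp: "q > 0" using q pos by simp
  \<comment> \<open>The entry that has to be positive is \<open>m\<close> times the form at
    \<open>(d, y)\<close>.\<close>
  have n3: "u * (q * t + A * w) - v * (k * t - A + \<beta> * w) =
      m * (t * d\<^sup>2 + 2 * A * d * y + \<gamma> * y\<^sup>2)"
    by (simp add: u_def v_def w_def \<gamma>_def q algebra_simps power2_eq_square)
  have n3_pos: "u * (q * t + A * w) - v * (k * t - A + \<beta> * w) > 0"
    unfolding n3 using pos by (intro mult_pos_pos pos_def_form t \<gamma>) auto
  define x z where "x = u * (q * t) - v * (k * t - A)" and "z = u * A - v * \<beta>"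
  define a' b' c' d' where "a' = (k * t - A + j * u * x) * (1 + l * w) + (\<beta> + j * u * z) * (l * w\<^sup>2)"
    and "b' = (\<beta> + j * u * z) * (1 - l * w) - (k * t - A + j * u * x) * l"
    and "c' = (q * t + j * v * x) * (1 + l * w) + (A + j * v * z) * (l * w\<^sup>2)"
    and "d' = (A + j * v * z) * (1 - l * w) - (q * t + j * v * x) * l"
  have c': "c' = q * t'"
    by (simp add: c'_def x_def z_def u_def v_def w_def l_def t'_def X_def Y_def \<gamma>_def q
        algebra_simps power2_eq_square)
  have a': "a' = k * t' - d'"
    by (simp add: a'_def d'_def x_def z_def u_def v_def w_def l_def t'_def X_def Y_def \<gamma>_def q
        algebra_simps power2_eq_square)
  have "a' * d' - b' * c' = (k * t - A) * A - \<beta> * (q * t)"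
    by (simp add: a'_def b'_def c'_def d'_def x_def z_def algebra_simps power2_eq_square)
  hence "a' * d' - b' * c' = 1" using det by simp
  moreover have "rademacher a' b' c' d' = of_int n + of_int (j - l)"
    unfolding a'_def b'_def c'_def d'_def x_def z_def rad[symmetric]
    using qp t' t n3_pos pos c' cop unfolding c'_def x_def z_def
    by (intro rademacher_parabolic det) (simp_all add: u_def v_def w_def)
  ultimately show ?thesis unfolding dedekind_level_def using t'
    by (intro exI[of _ t'] exI[of _ d'] exI[of _ b']) (simp add: a' c' l_def algebra_simps)
qed

text \<open>Take \<open>A = l\<close>, an inverse of \<open>k\<close> modulo \<open>q\<close>, and
  the form \<open>[l\<^sup>2 + 1, l; l, 1]\<close>; integrality of \<Phi> supplies the
  level.\<close>

lemma dedekind_level_base: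
  assumes "q > 0" "coprime k q"
  shows "\<exists>n. dedekind_level q k n"
proof -
  obtain l where "[k * l = 1] (mod q)" using assms(2) by (meson cong_solve_coprime_int)
  then obtain \<beta> where \<beta>: "k * l - 1 = q * \<beta>" by (auto simp: cong_iff_dvd_diff)
  have "(k * (l\<^sup>2 + 1) - l) * l - \<beta> * (q * (l\<^sup>2 + 1)) = (k * l - q * \<beta>) * (l\<^sup>2 + 1) - l\<^sup>2"
    by (simp add: algebra_simps power2_eq_square)
  also have "k * l - q * \<beta> = 1" using \<beta> by simp
  finally have det: "(k * (l\<^sup>2 + 1) - l) * l - \<beta> * (q * (l\<^sup>2 + 1)) = 1" by simp
  moreover have "l\<^sup>2 + 1 > 0" by (simp add: add_nonneg_pos)
  ultimately show ?thesis
    using rademacher_in_Ints[OF det] unfolding dedekind_level_def Ints_def by blast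
qed

lemma dedekind_level_value:
  assumes "q > 0" "dedekind_level q k n"
  obtains t A where "t > 0" "t dvd A\<^sup>2 + 1" "coprime A (q * t)"
    "norm_dedekind_sum A (q * t) = of_int (k - q * n) / of_int q"
proof -
  obtain t A \<beta> where t: "t > 0" and det: "(k * t - A) * A - \<beta> * (q * t) = 1"
    and rad: "rademacher (k * t - A) \<beta> (q * t) A = of_int n"
    using assms(2) by (auto simp: dedekind_level_def)
  have "A\<^sup>2 + 1 = t * (k * A - \<beta> * q)" using det by (simp add: algebra_simps power2_eq_square)
  moreover have "coprime A (q * t)"
    by (rule coprimeI) (metis det dvd_diff dvd_mult)
  moreover have "norm_dedekind_sum A (q * t) = of_int (k - q * n) / of_int q"
    using rad assms(1) t by (auto simp: rademacher_def field_simps)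
  ultimately show ?thesis using that[of t A] t by simp
qed

lemma dedekind_level_prime_step:
  fixes q k n p j :: int
  assumes "q > 0" "coprime k q" "prime p" "p dvd q" "dedekind_level q k n"
  shows "dedekind_level q k (n + j * (p\<^sup>2 - 1))"
proof -
  have p: "p > 1" using assms(3) by (simp add: prime_gt_1_int)
  obtain m where m: "q = p * m" using assms(4) by blast
  have mp: "m > 0" using assms(1) p m by (simp add: zero_less_mult_iff)
  \<comment> \<open>With \<open>y\<close> the part of \<open>q\<close> prime to \<open>p\<close>,
    \<open>p + k * y\<close> is coprime to \<open>y\<close> because \<open>p\<close> is, and coprime
    to \<open>p\<close> because \<open>k * y\<close> is.\<close>
  obtain y where y: "q = p ^ multiplicity p q * y" "\<not> p dvd y"
    using assms(1) p multiplicity_decompose'[of q p] by auto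
  have yp: "y > 0" using y(1) assms(1) p by (metis zero_less_mult_pos zero_less_power less_trans zero_less_one)
  have py: "coprime p y" using y(2) assms(3) by (simp add: prime_imp_coprime)
  have pk: "coprime p k" using assms(2,4) by (metis coprime_commute coprime_divisors dvd_refl)
  have "coprime (p + k * y) y"
    using py by (simp add: gcd_add_mult coprime_iff_gcd_eq_1 gcd.commute add.commute mult.commute)
      (metis gcd_add_mult gcd.commute mult.commute add.commute)
  moreover have "coprime (p + k * y) p"
    using py pk by (metis coprime_commute coprime_mult_left_iff gcd_add2 coprime_iff_gcd_eq_1)
  ultimately have "coprime (p + k * y) (q * y)" by (subst y(1)) simp
  from dedekind_level_step[OF assms(5) m _ mp yp this, of "- j"] p
  show ?thesis by (simp add: algebra_simps)
qed

text \<open>It suffices to find a matrix \<open>[q * A, b; t, z]\<close> of determinant 1 with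
  \<open>q * z = - A\<close> and \<Phi>-value \<open>j * (d\<^sup>2 - 1)\<close>. Then
  \<open>q\<close> times its trace is \<open>(q\<^sup>2 - 1) * A\<close>, and \<open>z\<close>
  inverts \<open>A * q\<close> modulo \<open>t\<close>, so \<open>q\<close> times its value is the
  defining expression of an element of \<Lambda>.\<close>

lemma Lambda_set_memI:
  fixes q d j :: int
  assumes "q > 0" "d > 0" "d dvd q"
  shows "(q * j * (d\<^sup>2 - 1)) mod (q\<^sup>2 - 1) \<in> Lambda_set q"
proof -
  obtain m where m: "q = d * m" using assms(3) by blast
  have mp: "m > 0" using assms(1,2) m by (simp add: zero_less_mult_iff)
  txt \<open>These come from \<open>rademacher_parabolic\<close> for \<open>[0, -1; 1, 0]\<close> with \<open>u = q d\<close>, \<open>v = 1\<close>, \<open>w = q / d\<close>.\<close>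
  define i where "i = - j"
  define l where "l = i * d\<^sup>2"
  define t where "t = (1 + i * q * d)\<^sup>2 + (i * q)\<^sup>2"
  define A where "A = i * q * (d\<^sup>2 * (1 + i * q * d) - (1 - i * q * d))"
  define z where "z = i * (1 - i * q * d) - l * (1 + i * q * d)"
  define b where "b = (i * q * d - 1) * (1 - i * q * d) - i * (q * d)\<^sup>2 * l"
  have t: "t > 0"
  proof -
    have "i * q \<noteq> 0 \<or> 1 + i * q * d \<noteq> 0" by auto
    thus ?thesis unfolding t_def by (metis add_nonneg_pos add_pos_nonneg zero_le_power2 zero_less_power2)
  qed
  have zA: "q * z = - A"
    by (simp add: A_def z_def l_def algebra_simps power2_eq_square)
  have det: "(q * A) * z - b * t = 1"
    by (simp add: A_def b_def z_def t_def l_def algebra_simps power2_eq_square)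
  have lm: "l * m = i * q * d" "l * m\<^sup>2 = i * q\<^sup>2"
    by (simp_all add: l_def m power2_eq_square)
  have "rademacher (q * A) b t z = rademacher 0 (- 1) 1 0 + of_int (i - l)"
  proof -
    have "0 < (1 + i * 1 * (q * d * 1 - 1 * 0)) * (1 + l * m) + (0 + i * 1 * (q * d * 0 - 1 * - 1)) * (l * m\<^sup>2)"
      unfolding lm using t by (simp add: t_def algebra_simps power2_eq_square)
    moreover have "m + d * q > 0" using mp assms by (simp add: add_pos_pos)
    ultimately show ?thesis using rademacher_parabolic[of 0 0 "- 1" 1 1 m "q * d" i l] mp
      unfolding lm by (simp add: A_def b_def z_def t_def l_def algebra_simps power2_eq_square)
  qed
  hence rad: "rademacher (q * A) b t z = of_int (i - l)"
    by (simp add: rademacher_def norm_dedekind_sum_0_1)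
  have "t * (- b) = A * (- (q * z)) + 1" using det by (simp add: algebra_simps)
  hence dvd: "t dvd A\<^sup>2 + 1" unfolding zA by (metis dvd_triv_left minus_minus power2_eq_square)
  have cop: "coprime (A * q) t"
    by (rule coprimeI) (metis det dvd_diff dvd_mult dvd_mult2 mult.commute)
  have "[z * (A * q) = 1] (mod t)"
    using det by (simp add: cong_iff_dvd_diff) (metis add_diff_cancel_left' diff_add_cancel dvd_triv_right mult.commute)
  hence S: "norm_dedekind_sum (A * q) t = norm_dedekind_sum z t"
    by (rule norm_dedekind_sum_inverse[OF t])
  have "of_int (q * A + z) / of_int t - norm_dedekind_sum z t = of_int (i - l)"
    using rad t by (simp add: rademacher_def)
  hence "of_int q * (of_int (q * A + z) / of_int t - norm_dedekind_sum z t) = of_int (q * (i - l))"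
    by (simp only: of_int_mult)
  hence "of_int (q * (q * A + z)) / of_int t - of_int q * norm_dedekind_sum z t = of_int (q * (i - l))"
    by (simp only: right_diff_distrib times_divide_eq_right of_int_mult)
  moreover have "q * (q * A + z) = (q\<^sup>2 - 1) * A"
    using zA by (simp add: algebra_simps power2_eq_square)
  ultimately have "real_of_int (q * (i - l)) =
      of_int ((q\<^sup>2 - 1) * A) / of_int t - of_int q * norm_dedekind_sum (A * q) t"
    unfolding S by simp
  moreover have "q * (i - l) = q * j * (d\<^sup>2 - 1)" by (simp add: l_def i_def algebra_simps)
  ultimately have "real_of_int (q * j * (d\<^sup>2 - 1)) =
      of_int ((q\<^sup>2 - 1) * A) / of_int t - of_int q * norm_dedekind_sum (A * q) t" by simp
  thus ?thesis unfolding Lambda_set_def using t dvd cop by blast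
qed

section \<open>Congruences modulo 3 and 8\<close>

lemma norm_dedekind_sum_int:
  assumes "b > 0" "coprime a b"
  obtains D where "of_int b * norm_dedekind_sum a b = of_int D"
    "b * D = 12 * (\<Sum>k\<in>{0..<b}. k * (a * k mod b)) - 3 * b\<^sup>2 * (b - 1)"
proof -
  obtain D where D: "of_int b * norm_dedekind_sum a b = of_int D"
    using norm_dedekind_sum_floors[OF assms] by metis
  hence "real_of_int (b * D) = of_int (12 * (\<Sum>k\<in>{0..<b}. k * (a * k mod b)) - 3 * b\<^sup>2 * (b - 1))"
    using norm_dedekind_sum_formula[OF assms] by (simp add: power2_eq_square mult.assoc)
  thus ?thesis using that D by (simp only: of_int_eq_iff)
qed

lemma three_dvd_norm_dedekind_sum:
  assumes "b > 0" "coprime a b" "\<not> 3 dvd b" "of_int b * norm_dedekind_sum a b = of_int D"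
  shows "3 dvd D"
proof -
  obtain D' where D': "of_int b * norm_dedekind_sum a b = of_int D'"
    "b * D' = 12 * (\<Sum>k\<in>{0..<b}. k * (a * k mod b)) - 3 * b\<^sup>2 * (b - 1)"
    using norm_dedekind_sum_int[OF assms(1,2)] .
  have "D' = D" using D'(1) assms(4) by simp
  hence "b * D = 3 * (4 * (\<Sum>k\<in>{0..<b}. k * (a * k mod b)) - b\<^sup>2 * (b - 1))" using D'(2) by simp
  hence "3 dvd b * D" by (metis dvd_triv_left)
  moreover have "prime (3 :: int)" by simp
  ultimately show ?thesis using assms(3) by (simp add: prime_dvd_mult_iff)
qed

lemma square_add_1_not_dvd:
  fixes a t :: int
  assumes "t dvd a\<^sup>2 + 1"
  shows "\<not> 3 dvd t" "\<not> 4 dvd t"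
proof -
  show "\<not> 3 dvd t"
  proof
    assume "3 dvd t"
    hence "(a\<^sup>2 + 1) mod 3 = 0" using assms dvd_trans by auto
    hence "((a mod 3)\<^sup>2 + 1) mod 3 = 0" by (metis mod_add_left_eq power_mod)
    moreover have "a mod 3 \<in> {0, 1, 2}" by auto
    ultimately show False by auto
  qed
  show "\<not> 4 dvd t"
  proof
    assume "4 dvd t"
    hence "(a\<^sup>2 + 1) mod 4 = 0" using assms dvd_trans by auto
    hence "((a mod 4)\<^sup>2 + 1) mod 4 = 0" by (metis mod_add_left_eq power_mod)
    moreover have "a mod 4 \<in> {0, 1, 2, 3}" by auto
    ultimately show False by auto
  qed
qed

section \<open>Gauss's lemma and multiplication by squares modulo 8\<close>

definition parity_sign :: "int \<Rightarrow> int" where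
  "parity_sign n = (if odd n then - 1 else 1)"

lemma parity_sign_simps [simp]:
  "parity_sign n * parity_sign n = 1" "parity_sign n * (parity_sign n * m) = m"
  by (auto simp: parity_sign_def)

lemma parity_sign_sum: "finite A \<Longrightarrow> parity_sign (sum f A) = (\<Prod>k\<in>A. parity_sign (f k))"
  by (induction A rule: finite_induct) (auto simp: parity_sign_def)

text \<open>For odd \<open>b\<close> coprime to \<open>a\<close> this is the Jacobi symbol as in
  Gauss's lemma: even nonzero residues are the negatives of odd ones, so a factor is -1 exactly when
  \<open>a * k\<close> leaves the odd half system.\<close>

definition gauss_sign :: "int \<Rightarrow> int \<Rightarrow> int" where
  "gauss_sign b a = (\<Prod>k\<in>{k\<in>{0..<b}. odd k}. parity_sign (a * k mod b) * parity_sign (k mod b))"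

lemma parity_sign_minus_mod:
  fixes b x :: int
  assumes "odd b" "b > 0" "\<not> b dvd x"
  shows "parity_sign ((- x) mod b) = - parity_sign (x mod b)"
  using assms by (auto simp: parity_sign_def zmod_zminus1_eq_if)

text \<open>
  Gauss's lemma with the odd residues as half system: \<open>\<epsilon>(a x) \<epsilon>(x)\<close> is even in \<open>x\<close>, so its
  product over the half system does not change when the half system is multiplied by \<open>c\<close>.
\<close>

lemma gauss_sign_mult:
  fixes a b c :: int
  assumes b: "b > 0" "odd b" and cop: "coprime a b" "coprime c b"
  shows "gauss_sign b (a * c) = gauss_sign b a * gauss_sign b c"
proof -
  let ?O = "{k\<in>{0..<b}. odd k}"
  define h where "h x = parity_sign (a * x mod b) * parity_sign (x mod b)" for x
  \<comment> \<open>\<open>\<sigma> k\<close> is the odd one among the residues of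
    \<open>c * k\<close> and \<open>- (c * k)\<close>; they have opposite parity because
    \<open>b\<close> is odd.\<close>
  define \<sigma> where "\<sigma> k = (if odd (c * k mod b) then c * k mod b else b - c * k mod b)" for k
  have nd: "\<not> b dvd c * k" if "k \<in> ?O" for k
  proof
    assume "b dvd c * k"
    hence "b dvd k" using cop(2) by (simp add: coprime_commute coprime_dvd_mult_right_iff)
    thus False using that by (auto dest!: zdvd_imp_le simp: le_less)
  qed
  have h_minus: "h (- x) = h x" if "\<not> b dvd x" for x
  proof -
    have "\<not> b dvd a * x" using that cop(1) by (simp add: coprime_commute coprime_dvd_mult_right_iff)
    thus ?thesis using that b by (simp add: h_def parity_sign_minus_mod)
  qed
  have h_mod: "h x = h y" if "[x = y] (mod b)" for x y
    using that unfolding h_def by (metis cong_def cong_scalar_left)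
  have \<sigma>_cong: "[\<sigma> k = c * k] (mod b) \<or> [\<sigma> k = - (c * k)] (mod b)" for k
    by (auto simp: \<sigma>_def cong_def mod_simps)
  have h\<sigma>: "h (\<sigma> k) = h (c * k)" if "k \<in> ?O" for k
    using \<sigma>_cong[of k] h_mod h_minus[OF nd[OF that]] by metis
  have bij: "bij_betw \<sigma> ?O ?O"
  proof -
    have sub: "\<sigma> ` ?O \<subseteq> ?O"
    proof (rule image_subsetI)
      fix k assume k: "k \<in> ?O"
      define w where "w = c * k mod b"
      have "w \<noteq> 0" "0 \<le> w" "w < b" using nd[OF k] b by (auto simp: w_def)
      thus "\<sigma> k \<in> ?O" using b unfolding \<sigma>_def w_def[symmetric] by auto
    qed
    have inj: "inj_on \<sigma> ?O"
    proof (rule inj_onI)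
      fix k l assume kl: "k \<in> ?O" "l \<in> ?O" "\<sigma> k = \<sigma> l"
      have "[c * k = c * l] (mod b) \<or> [c * k = - (c * l)] (mod b)"
        using \<sigma>_cong[of k] \<sigma>_cong[of l] kl(3) by (auto simp: cong_def) (metis mod_minus_eq minus_minus)+
      hence "[c * k = c * l] (mod b) \<or> [c * k = c * (- l)] (mod b)" by simp
      hence "[k = l] (mod b) \<or> [k = - l] (mod b)" using cop(2) by (metis cong_mult_lcancel)
      thus "k = l"
      proof
        assume "[k = l] (mod b)"
        thus ?thesis using kl by (simp add: cong_def)
      next
        assume "[k = - l] (mod b)"
        \<comment> \<open>Impossible: as \<open>k + l\<close> lies strictly between 0 and
          \<open>2 * b\<close>, it would be \<open>b\<close>, which is odd, while \<open>k\<close>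
          and \<open>l\<close> are both odd.\<close>
        hence "b dvd k + l" by (simp add: cong_iff_dvd_diff)
        then obtain m where m: "k + l = b * m" by blast
        have "0 < k + l" "k + l < b * 2" using kl by (auto intro: add_nonneg_pos simp: le_less)
        hence "0 < m" "m < 2" using b unfolding m by (auto simp: zero_less_mult_iff)
        hence "k + l = b" using m by (cases "m = 1") auto
        thus ?thesis using kl b by auto
      qed
    qed
    have fin: "finite ?O" by (rule finite_subset[of _ "{0..<b}"]) auto
    show ?thesis unfolding bij_betw_def by (intro conjI inj endo_inj_surj fin sub)
  qed
  have "gauss_sign b (a * c) = (\<Prod>k\<in>?O. h (c * k) * (parity_sign (c * k mod b) * parity_sign (k mod b)))"
    unfolding gauss_sign_def by (intro prod.cong refl) (simp add: h_def mult.assoc)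
  also have "\<dots> = (\<Prod>k\<in>?O. h (c * k)) * gauss_sign b c"
    unfolding gauss_sign_def by (rule prod.distrib)
  also have "(\<Prod>k\<in>?O. h (c * k)) = (\<Prod>k\<in>?O. h (\<sigma> k))"
    by (intro prod.cong refl) (simp only: h\<sigma>)
  also have "(\<Prod>k\<in>?O. h (\<sigma> k)) = (\<Prod>k\<in>?O. h k)" by (rule prod.reindex_bij_betw[OF bij])
  finally show ?thesis by (simp add: gauss_sign_def h_def)
qed

lemma gauss_sign_square: "gauss_sign b a * gauss_sign b a = 1"
  unfolding gauss_sign_def prod.distrib[symmetric] by (intro prod.neutral) (simp add: mult.assoc mult.left_commute)

text \<open>Only odd \<open>k\<close> influence the parity. The second factor is independent of
  \<open>a\<close>, so the dependence on \<open>a\<close> is that of the multiplicative Gauss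
  sign.\<close>

lemma parity_sign_sum_residues:
  "parity_sign (\<Sum>k\<in>{0..<b}. k * (a * k mod b)) =
    gauss_sign b a * (\<Prod>k\<in>{k\<in>{0..<b}. odd k}. parity_sign (k mod b))"
proof -
  have "parity_sign (\<Sum>k\<in>{0..<b}. k * (a * k mod b)) =
      (\<Prod>k\<in>{0..<b}. if odd k then parity_sign (a * k mod b) else 1)"
    by (subst parity_sign_sum) (auto simp: parity_sign_def intro!: prod.cong)
  also have "\<dots> = (\<Prod>k\<in>{k\<in>{0..<b}. odd k}. parity_sign (a * k mod b))"
    by (rule prod.inter_filter[symmetric]) simp
  also have "\<dots> = (\<Prod>k\<in>{k\<in>{0..<b}. odd k}. (parity_sign (a * k mod b) * parity_sign (k mod b)) * parity_sign (k mod b))"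
    by (intro prod.cong refl) (simp add: mult.assoc)
  finally show ?thesis by (simp add: gauss_sign_def prod.distrib)
qed

text \<open>The Gauss sign of a square is 1, so the sums \<open>E\<close> for \<open>a\<close> and
  \<open>a * r\<^sup>2\<close> have equal parity. They enter with coefficient 12, so
  \<open>b * (D' - D)\<close> is a multiple of 24, and \<open>b\<close> is odd.\<close>

lemma norm_dedekind_sum_mult_square_mod_8:
  fixes a b r D D' :: int
  assumes b: "b > 0" "odd b" and cop: "coprime a b" "coprime r b"
    and D: "of_int b * norm_dedekind_sum a b = of_int D"
    and D': "of_int b * norm_dedekind_sum (a * r\<^sup>2) b = of_int D'"
  shows "[D' = D] (mod 8)"
proof -
  define E where "E a = (\<Sum>k\<in>{0..<b}. k * (a * k mod b))" for a
  have cop': "coprime (a * r\<^sup>2) b" "coprime (a * r) b" using cop by simp_all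
  have "gauss_sign b (a * r\<^sup>2) = gauss_sign b a"
    using gauss_sign_mult[OF b cop'(2) cop(2)] gauss_sign_mult[OF b cop] gauss_sign_square[of b r]
    by (simp add: power2_eq_square mult.assoc)
  hence "parity_sign (E (a * r\<^sup>2)) = parity_sign (E a)"
    by (simp add: E_def parity_sign_sum_residues)
  hence "even (E (a * r\<^sup>2) - E a)" by (auto simp: parity_sign_def split: if_splits)
  then obtain m where m: "E (a * r\<^sup>2) - E a = 2 * m" by blast
  have eq: "b * F = 12 * E x - 3 * b\<^sup>2 * (b - 1)"
    if x: "coprime x b" and F: "of_int b * norm_dedekind_sum x b = of_int F" for x F
  proof -
    obtain G where G: "of_int b * norm_dedekind_sum x b = of_int G"
      "b * G = 12 * (\<Sum>k\<in>{0..<b}. k * (x * k mod b)) - 3 * b\<^sup>2 * (b - 1)"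
      using norm_dedekind_sum_int[OF b(1) x] .
    have "G = F" using F unfolding G(1) by simp
    thus ?thesis using G(2) by (simp only: E_def)
  qed
  from eq[OF cop(1) D] eq[OF cop'(1) D'] have "b * (D' - D) = 8 * (3 * m)" using m by (simp add: algebra_simps)
  hence "8 dvd b * (D' - D)" by (metis dvd_triv_left)
  moreover have "coprime 8 b" using b(2) coprime_power_left_iff[of 2 3 b] by simp
  ultimately show ?thesis by (simp add: cong_iff_dvd_diff coprime_dvd_mult_right_iff)
qed

section \<open>Reduction of even moduli\<close>

lemma sawtooth_duplication: "sawtooth x + sawtooth (x + 1 / 2) = sawtooth (2 * x)"
proof -
  define n where "n = \<lfloor>x\<rfloor>"
  define y where "y = x - of_int n"
  have y: "0 \<le> y" "y < 1" unfolding y_def n_def by linarith+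
  have x: "x = y + of_int n" by (simp add: y_def)
  have int: "z \<notin> \<int>" if "0 < z" "z < 1" for z :: real
    using that by (auto elim!: Ints_cases)
  have ev: "sawtooth z = z - 1 / 2" if "0 < z" "z < 1" for z
    using that int[OF that] by (simp add: sawtooth_def frac_eq)
  have z0: "sawtooth 0 = 0" "sawtooth 1 = 0" by (simp_all add: sawtooth_def)
  have shift: "sawtooth z = sawtooth (z - 1)" for z
    using sawtooth_add_int[of "z - 1" 1] by simp
  have "sawtooth y + sawtooth (y + 1 / 2) = sawtooth (2 * y)"
  proof -
    consider "y = 0" | "0 < y" "y < 1 / 2" | "y = 1 / 2" | "1 / 2 < y" using y by linarith
    thus ?thesis
    proof cases
      case 3
      show ?thesis unfolding 3 by (simp add: ev z0)
    next
      case 4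
      thus ?thesis using shift[of "y + 1 / 2"] shift[of "2 * y"] y by (simp add: ev)
    qed (auto simp: ev z0)
  qed
  moreover have "sawtooth (x + 1 / 2) = sawtooth (y + 1 / 2)"
    using sawtooth_add_int[of "y + 1 / 2" n] by (simp add: x algebra_simps)
  moreover have "sawtooth (2 * x) = sawtooth (2 * y)"
    using sawtooth_add_int[of "2 * y" "2 * n"] by (simp add: x algebra_simps)
  ultimately show ?thesis by (simp add: x)
qed

lemma sum_halves:
  fixes s :: int
  assumes "s > 0"
  shows "(\<Sum>k\<in>{0..<2 * s}. f k) = (\<Sum>k\<in>{0..<s}. f k + f (k + s) :: real)"
proof -
  have "{0..<2 * s} = {0..<s} \<union> {s..<2 * s}" using assms by auto
  hence "(\<Sum>k\<in>{0..<2 * s}. f k) = (\<Sum>k\<in>{0..<s}. f k) + (\<Sum>k\<in>{s..<2 * s}. f k)"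
    by (simp add: sum.union_disjoint)
  also have "(\<Sum>k\<in>{s..<2 * s}. f k) = (\<Sum>k\<in>{0..<s}. f (k + s))"
    by (rule sum.reindex_bij_witness[of _ "\<lambda>k. k + s" "\<lambda>k. k - s"]) auto
  finally show ?thesis by (simp add: sum.distrib)
qed

lemma sum_even_terms:
  fixes s :: int
  assumes "s > 0"
  shows "(\<Sum>k\<in>{0..<2 * s}. if even k then f k else 0) = (\<Sum>k\<in>{0..<s}. f (2 * k) :: real)"
proof -
  have "(\<Sum>k\<in>{0..<2 * s}. if even k then f k else 0) = (\<Sum>k\<in>{k\<in>{0..<2 * s}. even k}. f k)"
    by (rule sum.inter_filter[symmetric]) simp
  also have "\<dots> = (\<Sum>k\<in>{0..<s}. f (2 * k))"
    by (rule sum.reindex_bij_witness[of _ "\<lambda>k. 2 * k" "\<lambda>k. k div 2"]) auto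
  finally show ?thesis .
qed

text \<open>Pair \<open>k\<close> with \<open>k + s\<close>: the second factor is unchanged, and the
  first factors add up by duplication.\<close>

lemma sum_sawtooth_double:
  fixes s c :: int
  assumes "s > 0"
  shows "(\<Sum>k\<in>{0..<2 * s}. sawtooth (of_int k / of_int (2 * s)) * sawtooth (of_int (c * k) / of_int s)) =
    dedekind_sum c s"
proof -
  have "sawtooth (of_int k / of_int (2 * s)) * sawtooth (of_int (c * k) / of_int s) +
      sawtooth (of_int (k + s) / of_int (2 * s)) * sawtooth (of_int (c * (k + s)) / of_int s) =
      sawtooth (of_int k / of_int s) * sawtooth (of_int (c * k) / of_int s)" for k
  proof -
    have "sawtooth (of_int (c * (k + s)) / of_int s) = sawtooth (of_int (c * k) / of_int s)"
      using assms by (intro sawtooth_divide_cong) (auto simp: cong_iff_dvd_diff algebra_simps)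
    moreover have "of_int (k + s) / of_int (2 * s) = of_int k / of_int (2 * s) + 1 / (2::real)"
      using assms by (simp add: field_simps)
    moreover have "2 * (of_int k / of_int (2 * s)) = (of_int k / of_int s :: real)" by simp
    ultimately show ?thesis using sawtooth_duplication[of "of_int k / of_int (2 * s)"]
      by (metis distrib_right)
  qed
  thus ?thesis using assms by (simp only: sum_halves dedekind_sum_alt)
qed

text \<open>The Petersson--Knopp identity for the prime 2.\<close>

lemma dedekind_sum_hecke_2:
  assumes "s > 0"
  shows "dedekind_sum a (2 * s) + dedekind_sum (a + s) (2 * s) + dedekind_sum (2 * a) s = 3 * dedekind_sum a s"
proof -
  let ?f = "\<lambda>k. sawtooth (of_int k / of_int (2 * s))"
  let ?g = "\<lambda>c k. sawtooth (of_int (c * k) / of_int s)"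
  let ?h = "\<lambda>c k. sawtooth (of_int (c * k) / of_int (2 * s))"
  \<comment> \<open>For even \<open>k\<close> the two values coincide; for odd \<open>k\<close>
    their arguments differ by 1/2 modulo 1, so duplication applies.\<close>
  have pair: "?h a k + ?h (a + s) k = ?g a k + (if even k then 2 * ?h a k - ?g a k else 0)" for k
  proof (cases "even k")
    case True
    hence "?h (a + s) k = ?h a k"
      using assms by (intro sawtooth_divide_cong) (auto simp: cong_iff_dvd_diff algebra_simps)
    thus ?thesis using True by simp
  next
    case False
    then obtain l where k: "k = 2 * l + 1" by (elim oddE)
    have "of_int ((a + s) * k) / of_int (2 * s) = of_int (a * k) / of_int (2 * s) + 1 / 2 + (of_int l :: real)"
      using assms by (simp add: k field_simps)
    hence "?h (a + s) k = sawtooth (of_int (a * k) / of_int (2 * s) + 1 / 2)"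
      by (metis sawtooth_add_int)
    moreover have "2 * (of_int (a * k) / of_int (2 * s)) = (of_int (a * k) / of_int s :: real)" by simp
    ultimately show ?thesis
      using False sawtooth_duplication[of "of_int (a * k) / of_int (2 * s)"] by simp
  qed
  have "dedekind_sum a (2 * s) + dedekind_sum (a + s) (2 * s) =
      (\<Sum>k\<in>{0..<2 * s}. ?f k * (?h a k + ?h (a + s) k))"
    using assms by (simp add: dedekind_sum_alt sum.distrib distrib_left)
  also have "\<dots> = (\<Sum>k\<in>{0..<2 * s}. ?f k * ?g a k + (if even k then ?f k * (2 * ?h a k - ?g a k) else 0))"
    unfolding pair by (intro sum.cong refl) (simp add: distrib_left)
  also have "\<dots> = dedekind_sum a s + (\<Sum>k\<in>{0..<s}. ?f (2 * k) * (2 * ?h a (2 * k) - ?g a (2 * k)))"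
    unfolding sum.distrib sum_sawtooth_double[OF assms] sum_even_terms[OF assms] ..
  also have "(\<Sum>k\<in>{0..<s}. ?f (2 * k) * (2 * ?h a (2 * k) - ?g a (2 * k))) =
      (\<Sum>k\<in>{0..<s}. 2 * (sawtooth (of_int k / of_int s) * ?g a k) - sawtooth (of_int k / of_int s) * ?g (2 * a) k)"
    by (intro sum.cong refl) (simp add: right_diff_distrib mult_ac)
  also have "\<dots> = 2 * dedekind_sum a s - dedekind_sum (2 * a) s"
    using assms by (simp add: sum_subtractf dedekind_sum_alt sum_distrib_left)
  finally show ?thesis by simp
qed

text \<open>The fraction \<open>(a + s) / (2 * s)\<close> is \<open>h / s\<close>, so every other
  term of the Petersson--Knopp identity has modulus \<open>s\<close>.\<close>

lemma norm_dedekind_sum_double: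
  assumes "s > 0" "a + s = 2 * h"
  shows "norm_dedekind_sum a (2 * s) =
    3 * norm_dedekind_sum a s - norm_dedekind_sum (2 * a) s - norm_dedekind_sum h s"
proof -
  have "dedekind_sum (a + s) (2 * s) = dedekind_sum h s"
  proof -
    have "of_int ((a + s) * k) / of_int (2 * s) = (of_int (h * k) / of_int s :: real)" for k
      unfolding assms(2) by simp
    thus ?thesis
      using assms(1) sum_sawtooth_double[OF assms(1), of h] by (simp add: dedekind_sum_alt)
  qed
  thus ?thesis using dedekind_sum_hecke_2[OF assms(1), of a] by (simp add: norm_dedekind_sum_def)
qed

section \<open>Divisibility of values and of elements of \<Lambda>\<close>

lemma odd_square_mod_8:
  fixes r :: int
  assumes "odd r"
  shows "[r\<^sup>2 = 1] (mod 8)"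
proof -
  have "r mod 8 \<in> {0, 1, 2, 3, 4, 5, 6, 7}" by auto
  moreover have "odd (r mod 8)" using assms by (simp add: dvd_mod_iff)
  ultimately have "(r mod 8)\<^sup>2 mod 8 = 1" by auto
  thus ?thesis by (simp add: cong_def power_mod)
qed

lemma dedekind_value_dvd_3:
  assumes "q > 0" "t > 0" "t dvd A\<^sup>2 + 1" "coprime A (q * t)" "\<not> 3 dvd q"
    and "norm_dedekind_sum A (q * t) = of_int k / of_int q"
  shows "3 dvd k"
proof -
  have p3: "prime (3 :: int)" by simp
  have t3: "\<not> 3 dvd t" using square_add_1_not_dvd(1)[OF assms(3)] .
  have "of_int (q * t) * norm_dedekind_sum A (q * t) = of_int (t * k)"
    using assms by simp
  moreover have "\<not> 3 dvd q * t" using t3 assms(5) p3 by (simp add: prime_dvd_mult_iff)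
  ultimately have "3 dvd t * k"
    using three_dvd_norm_dedekind_sum[of "q * t" A "t * k"] assms by simp
  thus ?thesis using t3 p3 by (simp add: prime_dvd_mult_iff)
qed

text \<open>The modulus \<open>r\<^sup>2 * t\<close> may be even, so \<open>A\<close> is replaced by
  a positive odd \<open>B\<close> in its class and reciprocity moves to the modulus
  \<open>B\<close>. There the sums of \<open>t\<close> and \<open>t * r\<^sup>2\<close> agree modulo
  8 after multiplication by \<open>B\<close>, and the former is explicit because
  \<open>t dvd B\<^sup>2 + 1\<close> makes \<open>S(B, t)\<close> vanish.\<close>

lemma dedekind_value_dvd_8:
  fixes r t A k :: int
  assumes r: "r > 0" "odd r" and t: "t > 0" "t dvd A\<^sup>2 + 1" and cop: "coprime A (r\<^sup>2 * t)"
    and val: "norm_dedekind_sum A (r\<^sup>2 * t) = of_int k / of_int (r\<^sup>2)"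
  shows "8 dvd k"
proof -
  define q where "q = r\<^sup>2"
  have q: "q > 0" "odd q" "[q = 1] (mod 8)" using r odd_square_mod_8[OF r(2)] by (simp_all add: q_def)
  \<comment> \<open>If \<open>A\<close> is even, coprimality makes \<open>q * t\<close> odd, so one
    shift by \<open>q * t\<close> gives an odd number.\<close>
  define A0 where "A0 = (if odd A then A else A + q * t)"
  have A0: "odd A0" "[A0 = A] (mod q * t)"
    using cop q(2) by (auto simp: A0_def q_def cong_iff_dvd_diff)
  \<comment> \<open>An even multiple of \<open>q * t\<close> keeps the parity and is large enough
    for positivity.\<close>
  define B where "B = A0 + 2 * (q * t) * \<bar>A0\<bar>"
  have oddB: "odd B" using A0(1) by (simp add: B_def)
  have Bpos: "B > 0"
  proof -
    have "q * t \<ge> 1" using q t by (simp add: int_one_le_iff_zero_less)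
    from mult_right_mono[OF this, of "2 * \<bar>A0\<bar>"] have "2 * \<bar>A0\<bar> \<le> 2 * (q * t) * \<bar>A0\<bar>"
      by (simp add: mult_ac)
    moreover have "A0 \<noteq> 0" using A0(1) by auto
    ultimately show ?thesis unfolding B_def by linarith
  qed
  have "B - A0 = (q * t) * (2 * \<bar>A0\<bar>)" by (simp add: B_def)
  hence "[B = A0] (mod q * t)" unfolding cong_iff_dvd_diff by (metis dvd_triv_left)
  hence BA: "[B = A] (mod q * t)" using A0(2) by (rule cong_trans)
  have cop': "coprime B (q * t)" using BA cop by (metis cong_imp_coprime cong_sym coprime_commute q_def)
  have "[B = A] (mod t)" using BA by (rule cong_dvd_modulus) simp
  hence "[B\<^sup>2 + 1 = A\<^sup>2 + 1] (mod t)" by (intro cong_add cong_pow cong_refl)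
  hence tB: "t dvd B\<^sup>2 + 1" using t(2) by (simp add: cong_dvd_iff)
  then obtain t' where t': "B\<^sup>2 + 1 = t * t'" by blast
  have S: "norm_dedekind_sum B (q * t) = of_int k / of_int q"
    using norm_dedekind_sum_cong[OF _ BA] q t val by (simp add: q_def)
  obtain D1 where D1: "of_int B * norm_dedekind_sum t B = of_int D1"
    using norm_dedekind_sum_int[OF Bpos, of t] cop' by (auto simp: coprime_commute)
  obtain D2 where D2: "of_int B * norm_dedekind_sum (t * r\<^sup>2) B = of_int D2"
    using norm_dedekind_sum_int[OF Bpos, of "t * r\<^sup>2"] cop' by (auto simp: coprime_commute q_def)
  have rB: "coprime r B" using cop' by (simp add: q_def coprime_commute)
  have D12: "[D2 = D1] (mod 8)"
    using cop' by (intro norm_dedekind_sum_mult_square_mod_8[OF Bpos oddB _ rB D1 D2]) (simp add: coprime_commute)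
  have "real_of_int (t * D1) = of_int (t * (t' + t - 3 * B))"
  proof -
    have "norm_dedekind_sum t B = (of_int B)\<^sup>2 / of_int (B * t) + (of_int t)\<^sup>2 / of_int (B * t) + 1 / of_int (B * t) - 3"
      using dedekind_reciprocity[OF Bpos t(1)] cop' norm_dedekind_sum_eq_0[OF t(1) tB] by simp
    hence "of_int t * (of_int B * norm_dedekind_sum t B) = (of_int B)\<^sup>2 + (of_int t)\<^sup>2 + 1 - 3 * of_int B * of_int t"
      using Bpos t by (simp add: field_simps power2_eq_square)
    also have "\<dots> = of_int (B\<^sup>2 + 1 + t\<^sup>2 - 3 * B * t)" by simp
    finally show ?thesis unfolding D1 t' by (simp add: algebra_simps power2_eq_square)
  qed
  hence e1: "D1 = t' + t - 3 * B" using t(1) by (simp only: of_int_eq_iff mult_cancel_left) simp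
  have "real_of_int (t * (B * k + q * D2)) = of_int (t * (t' + q\<^sup>2 * t - 3 * B * q))"
  proof -
    have "of_int k / of_int q + norm_dedekind_sum (t * r\<^sup>2) B = (of_int B)\<^sup>2 / of_int (B * (q * t))
        + (of_int (q * t))\<^sup>2 / of_int (B * (q * t)) + 1 / of_int (B * (q * t)) - 3"
      using dedekind_reciprocity[OF Bpos _ cop'] q t S by (simp add: q_def mult.commute)
    note eq = this
    have "of_int t * (of_int B * of_int k + of_int q * (of_int B * norm_dedekind_sum (t * r\<^sup>2) B)) =
        of_int (B * (q * t)) * (of_int k / of_int q + norm_dedekind_sum (t * r\<^sup>2) B)"
      using q(1) by (simp add: distrib_left)
    also have "\<dots> = (of_int B)\<^sup>2 + (of_int (q * t))\<^sup>2 + 1 - 3 * of_int B * of_int (q * t)"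
      unfolding eq using Bpos t(1) q(1) by (simp add: right_diff_distrib distrib_left)
    also have "\<dots> = of_int (B\<^sup>2 + 1 + (q * t)\<^sup>2 - 3 * B * (q * t))" by simp
    finally show ?thesis unfolding D2 t' by (simp add: algebra_simps power2_eq_square)
  qed
  hence e2: "B * k + q * D2 = t' + q\<^sup>2 * t - 3 * B * q"
    using t(1) by (simp only: of_int_eq_iff mult_cancel_left) simp
  \<comment> \<open>With \<open>q\<close> congruent to 1 and \<open>D2\<close> to \<open>D1\<close>,
    the right-hand side reduces to the expression for \<open>D1\<close> minus
    \<open>D1\<close>.\<close>
  have "B * k = t' + q\<^sup>2 * t - 3 * B * q - q * D2" using e2 by linarith
  also have "[t' + q\<^sup>2 * t - 3 * B * q - q * D2 = t' + 1\<^sup>2 * t - 3 * B * 1 - 1 * D1] (mod 8)"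
    by (intro cong_diff cong_add cong_mult cong_pow cong_refl q D12)
  finally have "8 dvd B * k" using e1 by (simp add: cong_0_iff)
  moreover have "coprime 8 B" using oddB coprime_power_left_iff[of 2 3 B] by simp
  ultimately show ?thesis by (simp add: coprime_dvd_mult_right_iff)
qed

lemma Lambda_value_dvd_3:
  fixes q a t L :: int
  assumes "t > 0" "t dvd a\<^sup>2 + 1" "coprime (a * q) t" "\<not> 3 dvd q"
    and L: "of_int L = of_int ((q\<^sup>2 - 1) * a) / of_int t - of_int q * norm_dedekind_sum (a * q) t"
  shows "3 dvd L"
proof -
  have t3: "\<not> 3 dvd t" using square_add_1_not_dvd(1)[OF assms(2)] .
  obtain D where D: "of_int t * norm_dedekind_sum (a * q) t = of_int D"
    using norm_dedekind_sum_int[OF assms(1,3)] by metis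
  have "3 dvd D" using three_dvd_norm_dedekind_sum[OF assms(1,3) t3 D] .
  moreover have "real_of_int (t * L) = of_int ((q\<^sup>2 - 1) * a - q * D)"
    using assms(1) by (simp add: L D[symmetric] field_simps)
  hence "t * L = (q\<^sup>2 - 1) * a - q * D" by (simp only: of_int_eq_iff)
  moreover have "3 dvd q\<^sup>2 - 1"
  proof -
    have "q mod 3 = 1 \<or> q mod 3 = 2" using assms(4) by presburger
    hence "(q mod 3)\<^sup>2 mod 3 = 1" by auto
    thus ?thesis by (simp add: power_mod mod_eq_dvd_iff[symmetric])
  qed
  ultimately have "3 dvd t * L" by simp
  thus ?thesis using t3 prime_dvd_mult_iff[of "3::int"] by simp
qed

text \<open>\<open>S(a, t)\<close> vanishes, and for odd \<open>t\<close> multiplying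
  \<open>a\<close> by \<open>r\<^sup>2\<close> changes \<open>t * S(a, t)\<close> by a multiple of
  8. For \<open>t = 2 * s\<close> the doubling formula leads to three sums of odd modulus
  \<open>s\<close>; 16 dividing \<open>q\<^sup>2 - 1\<close> leaves room to cancel the extra
  2.\<close>

lemma Lambda_value_dvd_8:
  fixes r a t L :: int
  assumes r: "odd r" and t: "t > 0" "t dvd a\<^sup>2 + 1" and cop: "coprime (a * r\<^sup>2) t"
    and L: "of_int L = of_int (((r\<^sup>2)\<^sup>2 - 1) * a) / of_int t - of_int (r\<^sup>2) * norm_dedekind_sum (a * r\<^sup>2) t"
  shows "8 dvd L"
proof -
  define q where "q = r\<^sup>2"
  have q: "[q = 1] (mod 8)" using odd_square_mod_8[OF r] by (simp add: q_def)
  then obtain i where i: "q - 1 = 8 * i" by (auto simp: cong_iff_dvd_diff)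
  have "q\<^sup>2 - 1 = (q - 1) * (q + 1)" by (simp add: power2_eq_square algebra_simps)
  moreover have "q = 8 * i + 1" using i by simp
  ultimately have q16: "q\<^sup>2 - 1 = 16 * (i * (4 * i + 1))" by (simp add: algebra_simps)
  have S0: "norm_dedekind_sum a t = 0" using norm_dedekind_sum_eq_0[OF t] .
  have 8: "8 dvd D" if "b > 0" "odd b" "coprime x b" "coprime r b" "of_int b * norm_dedekind_sum x b = of_int E"
      "of_int b * norm_dedekind_sum (x * r\<^sup>2) b = of_int (E + D)" for b x D E
    using norm_dedekind_sum_mult_square_mod_8[OF that] by (simp add: cong_iff_dvd_diff)
  have rt: "coprime a t" "coprime r t" using cop by simp_all
  show ?thesis
  proof (cases "odd t")
    case True
    obtain D where D: "of_int t * norm_dedekind_sum (a * r\<^sup>2) t = of_int D"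
      using norm_dedekind_sum_int[OF t(1) cop] by metis
    have "8 dvd D" using 8[of t a 0 D] t True rt D S0 by simp
    moreover have "real_of_int (t * L) = of_int ((q\<^sup>2 - 1) * a - q * D)"
      using t by (simp add: L D[symmetric] q_def field_simps)
    hence "t * L = (q\<^sup>2 - 1) * a - q * D" by (simp only: of_int_eq_iff)
    ultimately have "8 dvd t * L" using q16 by simp
    moreover have "coprime 8 t" using True coprime_power_left_iff[of 2 3 t] by simp
    ultimately show ?thesis by (simp add: coprime_dvd_mult_right_iff)
  next
    case False
    then obtain s where s: "t = 2 * s" by blast
    have sp: "s > 0" using s t by simp
    have odds: "odd s" using square_add_1_not_dvd(2)[OF t(2)] s by auto
    have odda: "odd a" using rt(1) s by auto
    have cs: "coprime a s" "coprime r s" using rt s by simp_all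
    obtain h where h: "a + s = 2 * h" using odda odds by (metis even_add evenE)
    have "coprime (2 * h) s" using cs(1) unfolding h[symmetric] by (metis add.commute coprime_iff_gcd_eq_1 gcd_add1)
    hence ch: "coprime h s" by simp
    have c2a: "coprime (2 * a) s" using cs(1) odds by simp
    have oddq: "odd q" using r by (simp add: q_def)
    have "even (q - 1)" using oddq by simp
    then obtain e where e: "q - 1 = 2 * e" by blast
    \<comment> \<open>The half needed for \<open>a * r\<^sup>2\<close> is
      \<open>h * r\<^sup>2\<close> up to a multiple of \<open>s\<close>, so all three sums arise by
      multiplication by \<open>r\<^sup>2\<close>.\<close>
    have h': "a * r\<^sup>2 + s = 2 * (h * r\<^sup>2 - s * e)"
    proof -
      have "2 * (h * q - s * e) = (a + s) * q - s * (q - 1)" unfolding h e by (simp add: algebra_simps)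
      thus ?thesis by (simp add: q_def algebra_simps)
    qed
    have hh: "norm_dedekind_sum (h * r\<^sup>2 - s * e) s = norm_dedekind_sum (h * r\<^sup>2) s"
      using sp by (intro norm_dedekind_sum_cong) (auto simp: cong_iff_dvd_diff)
    have ex: "\<exists>E D. of_int s * norm_dedekind_sum x s = of_int E \<and>
        of_int s * norm_dedekind_sum (x * r\<^sup>2) s = of_int (E + 8 * D)" if x: "coprime x s" for x
    proof -
      obtain E where E: "of_int s * norm_dedekind_sum x s = of_int E"
        using norm_dedekind_sum_int[OF sp x] by metis
      have "coprime (x * r\<^sup>2) s" using x cs(2) by simp
      then obtain F where F: "of_int s * norm_dedekind_sum (x * r\<^sup>2) s = of_int F"
        using norm_dedekind_sum_int[OF sp] by metis
      have "8 dvd F - E" using 8[OF sp odds x cs(2) E, of "F - E"] F by simp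
      then obtain D where "F = E + 8 * D" by (metis add.commute diff_add_cancel dvdE)
      thus ?thesis using E F by blast
    qed
    obtain E1 D1 where 1: "of_int s * norm_dedekind_sum a s = of_int E1"
      "of_int s * norm_dedekind_sum (a * r\<^sup>2) s = of_int (E1 + 8 * D1)" using ex[OF cs(1)] by blast
    obtain E2 D2 where 2: "of_int s * norm_dedekind_sum (2 * a) s = of_int E2"
      "of_int s * norm_dedekind_sum (2 * a * r\<^sup>2) s = of_int (E2 + 8 * D2)" using ex[OF c2a] by blast
    obtain E3 D3 where 3: "of_int s * norm_dedekind_sum h s = of_int E3"
      "of_int s * norm_dedekind_sum (h * r\<^sup>2) s = of_int (E3 + 8 * D3)" using ex[OF ch] by blast
    have scale: "of_int s * (3 * x - y - z) = 3 * (of_int s * x) - of_int s * y - of_int s * z" for x y z :: real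
      by (simp add: algebra_simps)
    \<comment> \<open>Since \<open>S(a, t) = 0\<close>, the combination of the \<open>E\<close>s
      vanishes, and only multiples of 8 remain for \<open>a * r\<^sup>2\<close>.\<close>
    have "of_int s * norm_dedekind_sum a (2 * s) = of_int (3 * E1 - E2 - E3)"
      unfolding norm_dedekind_sum_double[OF sp h] scale 1(1) 2(1) 3(1) by simp
    hence "real_of_int (3 * E1 - E2 - E3) = 0" using S0 s by simp
    hence E0: "3 * E1 - E2 - E3 = 0" by (simp only: of_int_eq_0_iff)
    have "of_int s * norm_dedekind_sum (a * r\<^sup>2) (2 * s) =
        of_int (3 * (E1 + 8 * D1) - (E2 + 8 * D2) - (E3 + 8 * D3))"
      unfolding norm_dedekind_sum_double[OF sp h'] hh scale 1(2) 2(2)[unfolded mult.assoc]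
        3(2) mult.assoc by simp
    also have "3 * (E1 + 8 * D1) - (E2 + 8 * D2) - (E3 + 8 * D3) = 8 * (3 * D1 - D2 - D3)"
      using E0 by simp
    finally have W: "of_int s * norm_dedekind_sum (a * r\<^sup>2) t = of_int (8 * (3 * D1 - D2 - D3))"
      by (simp only: s)
    have "real_of_int (2 * s * L) = of_int ((q\<^sup>2 - 1) * a) - 2 * of_int q * (of_int s * norm_dedekind_sum (a * r\<^sup>2) t)"
      using sp by (simp add: L s q_def field_simps)
    also have "\<dots> = of_int ((q\<^sup>2 - 1) * a - 2 * q * (8 * (3 * D1 - D2 - D3)))"
      unfolding W by simp
    finally have "2 * s * L = (q\<^sup>2 - 1) * a - 2 * q * (8 * (3 * D1 - D2 - D3))"
      by (simp only: of_int_eq_iff)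
    hence "s * L = 8 * (i * (4 * i + 1) * a - q * (3 * D1 - D2 - D3))"
      unfolding q16 by (simp add: algebra_simps)
    hence "8 dvd s * L" by simp
    moreover have "coprime 8 s" using odds coprime_power_left_iff[of 2 3 s] by simp
    ultimately show ?thesis by (simp add: coprime_dvd_mult_right_iff)
  qed
qed

section \<open>Values of Dedekind sums\<close>

text \<open>With \<open>a'\<close> inverse to \<open>a\<close> modulo \<open>b\<close>, integrality
  of \<Phi> makes \<open>(a + a') / b - k / q\<close> an integer. Clearing denominators gives
  \<open>q dvd b\<close> and \<open>t dvd a + a'\<close>, and \<open>a * a'\<close> is 1 modulo
  \<open>t\<close>.\<close>

lemma norm_dedekind_sum_denominator:
  fixes a b k q :: int
  assumes "b > 0" "coprime a b" "q > 0" "coprime k q"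
    and S: "norm_dedekind_sum a b = of_int k / of_int q"
  obtains t where "b = q * t" "t > 0" "t dvd a\<^sup>2 + 1"
proof -
  obtain a' where "[a * a' = 1] (mod b)" using assms(2) by (meson cong_solve_coprime_int)
  then obtain c where c: "a * a' - 1 = b * c" by (auto simp: cong_iff_dvd_diff)
  hence "a' * a - c * b = 1" by (simp add: algebra_simps)
  from rademacher_in_Ints[OF this] obtain n where "rademacher a' c b a = of_int n"
    by (auto elim: Ints_cases)
  hence "of_int (a' + a) / of_int b - of_int k / of_int q = real_of_int n"
    using assms(1) by (simp add: rademacher_def S)
  hence "real_of_int (q * (a' + a)) = of_int (b * (k + n * q))"
    using assms(1,3) by (simp add: field_simps)
  hence e: "q * (a' + a) = b * (k + n * q)" by (simp only: of_int_eq_iff)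
  hence "q dvd b * (k + n * q)" by (metis dvd_triv_left)
  moreover have "coprime q (k + n * q)"
    using assms(4) by (metis coprime_commute coprime_iff_gcd_eq_1 gcd_add_mult add.commute)
  ultimately have "q dvd b" by (simp add: coprime_dvd_mult_left_iff)
  then obtain t where t: "b = q * t" by blast
  have tp: "t > 0" using assms(1,3) t by (simp add: zero_less_mult_iff)
  have "a' + a = t * (k + n * q)" using e assms(3) unfolding t by simp
  moreover have "a\<^sup>2 + 1 = a * (a' + a) - t * (q * c)"
    using c t by (simp add: algebra_simps power2_eq_square)
  ultimately have "t dvd a\<^sup>2 + 1" by simp
  thus ?thesis using that t tp by blast
qed

lemma dedekind_value_necessary:
  fixes a b k q :: int
  assumes "b > 0" "coprime a b" "q > 0" "coprime k q"
    and S: "norm_dedekind_sum a b = of_int k / of_int q"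
  shows "\<not> 3 dvd q \<Longrightarrow> 3 dvd k" "odd q \<Longrightarrow> is_square q \<Longrightarrow> 8 dvd k"
proof -
  obtain t where t: "b = q * t" "t > 0" "t dvd a\<^sup>2 + 1"
    using norm_dedekind_sum_denominator[OF assms] .
  show "3 dvd k" if "\<not> 3 dvd q"
    using dedekind_value_dvd_3[OF assms(3) t(2,3) _ that] assms(2) S t(1) by simp
  show "8 dvd k" if odd: "odd q" and sq: "is_square q"
  proof -
    obtain r where r: "q = r\<^sup>2" using sq by (auto simp: is_nth_power_def)
    have "q = \<bar>r\<bar>\<^sup>2" "\<bar>r\<bar> > 0" "odd \<bar>r\<bar>" using r assms(3) odd by auto
    thus ?thesis using dedekind_value_dvd_8[of "\<bar>r\<bar>" t a k] assms(2) S t by simp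
  qed
qed

text \<open>Start at any level \<open>n\<close>. The necessary conditions, applied to the value
  \<open>(k - q * n) / q\<close> attained there, force congruences on \<open>n\<close> that let the
  prime steps 3, 8 and 24 lead to level 0.\<close>

lemma dedekind_value_exists:
  fixes k q :: int
  assumes q: "q > 0" "coprime k q" "even q \<or> is_square q \<and> (3 dvd q \<or> 5 dvd q)"
    and k3: "\<not> 3 dvd q \<Longrightarrow> 3 dvd k" and k8: "odd q \<Longrightarrow> 8 dvd k"
  shows "\<exists>a b. b \<ge> 1 \<and> coprime a b \<and> norm_dedekind_sum a b = of_int k / of_int q"
proof -
  obtain n where n: "dedekind_level q k n" using dedekind_level_base[OF q(1,2)] by blast
  obtain t A where tA: "t > 0" "t dvd A\<^sup>2 + 1" "coprime A (q * t)"
      "norm_dedekind_sum A (q * t) = of_int (k - q * n) / of_int q"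
    using dedekind_level_value[OF q(1) n] .
  have "coprime (k - q * n) q"
    using q(2) by (metis coprime_iff_gcd_eq_1 gcd.commute gcd_diff2 gcd_add_mult mult.commute diff_add_cancel add.commute)
  moreover have "q * t > 0" using q(1) tA(1) by simp
  ultimately have nec: "\<not> 3 dvd q \<Longrightarrow> 3 dvd k - q * n" "odd q \<Longrightarrow> is_square q \<Longrightarrow> 8 dvd k - q * n"
    using dedekind_value_necessary[of "q * t" A q "k - q * n"] q(1) tA by simp_all
  have n3: "3 dvd n" if "\<not> 3 dvd q"
  proof -
    have "3 dvd q * n" using nec(1)[OF that] k3[OF that] by (metis dvd_diff_right_iff dvd_diff_commute)
    thus ?thesis using that prime_dvd_mult_iff[of "3::int"] by simp
  qed
  have n8: "8 dvd n" if "odd q" "is_square q"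
  proof -
    have "8 dvd q * n" using nec(2)[OF that] k8[OF that(1)] by (metis dvd_diff_right_iff dvd_diff_commute)
    moreover have "coprime 8 q" using that(1) coprime_power_left_iff[of 2 3 q] by simp
    ultimately show ?thesis by (simp add: coprime_dvd_mult_right_iff)
  qed
  have step: "dedekind_level q k (n' + j * (p\<^sup>2 - 1))"
    if "prime p" "p dvd q" "dedekind_level q k n'" for p n' j
    using dedekind_level_prime_step[OF q(1,2) that] .
  have "dedekind_level q k 0"
  proof (cases "3 dvd q")
    case 3: True
    show ?thesis
    proof (cases "even q")
      case True
      \<comment> \<open>Steps 8 and 3 are both available, and
        \<open>1 - 2 * 8 + 5 * 3 = 0\<close>.\<close>
      thus ?thesis using step[of 2 "n + - 2 * n * (3\<^sup>2 - 1)" "5 * n"] step[OF _ 3 n, of "- 2 * n"] by simp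
    next
      case False
      then obtain i where "n = 8 * i" using n8 q(3) by auto
      thus ?thesis using step[OF _ 3 n, of "- i"] by simp
    qed
  next
    case 3: False
    then obtain i where i: "n = 3 * i" using n3 by auto
    show ?thesis
    proof (cases "even q")
      case True
      thus ?thesis using step[OF _ True n, of "- i"] i by simp
    next
      case False
      hence 5: "5 dvd q" and "8 dvd n" using q(3) 3 n8 by auto
      hence "24 dvd n" using i by presburger
      then obtain i where "n = 24 * i" by blast
      thus ?thesis using step[OF _ 5 n, of "- i"] by simp
    qed
  qed
  from dedekind_level_value[OF q(1) this] obtain t A where
    "t > 0" "coprime A (q * t)" "norm_dedekind_sum A (q * t) = of_int (k - q * 0) / of_int q" .
  moreover have "q * t \<ge> 1" using q(1) \<open>t > 0\<close> by (simp add: int_one_le_iff_zero_less)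
  ultimately show ?thesis by (intro exI[of _ A] exI[of _ "q * t"]) simp
qed

section \<open>Equality of \<Lambda> and \<Gamma>, and the classification of values\<close>

lemma Gamma_subset_Lambda:
  fixes q :: int
  assumes q: "q > 0" "even q \<or> is_square q \<and> (3 dvd q \<or> 5 dvd q)"
  shows "Gamma_set q \<subseteq> Lambda_set q"
proof -
  have mem: "(c * (d\<^sup>2 - 1)) mod (q\<^sup>2 - 1) \<in> Lambda_set q" if "d > 0" "d dvd q" for c d
  proof -
    \<comment> \<open>\<open>q\<close> is its own inverse modulo \<open>q\<^sup>2 - 1\<close>, so
      the choice \<open>j = q * c\<close> removes the factor \<open>q\<close>.\<close>
    have "[q * (q * c) * (d\<^sup>2 - 1) = c * (d\<^sup>2 - 1)] (mod (q\<^sup>2 - 1))"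
    proof -
      have "q * (q * c) * (d\<^sup>2 - 1) - c * (d\<^sup>2 - 1) = (q\<^sup>2 - 1) * (c * (d\<^sup>2 - 1))"
        by (simp add: algebra_simps power2_eq_square)
      thus ?thesis by (simp add: cong_iff_dvd_diff)
    qed
    thus ?thesis using Lambda_set_memI[OF q(1) that, of "q * c"] by (simp add: cong_def)
  qed
  \<comment> \<open>24 is a multiple of each step 3, 8, 24 belonging to
    \<open>d = 2, 3, 5\<close>.\<close>
  have "(24 * s) mod (q\<^sup>2 - 1) \<in> Lambda_set q" for s
    using q(2) mem[of 2 "8 * s"] mem[of 3 "3 * s"] mem[of 5 s] by (auto simp: mult.commute)
  moreover have "(12 * s) mod (q\<^sup>2 - 1) \<in> Lambda_set q" if "even q" for s
    using mem[of 2 "4 * s"] that by (auto simp: mult.commute)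
  ultimately show ?thesis using q(2) by (auto simp: Gamma_set_def)
qed

text \<open>Modulo \<open>N = q\<^sup>2 - 1\<close> the multiples of 24 are the multiples of
  \<open>gcd 24 N\<close>, so the factors 3 and 8 can be treated separately. Either \<open>q\<close>
  is divisible by 3 and \<open>N\<close> is prime to 3, or \<open>3 dvd L\<close>; likewise for 2
  and 8.\<close>

lemma Lambda_subset_Gamma:
  fixes q :: int
  assumes q: "q \<ge> 2" "even q \<or> is_square q"
  shows "Lambda_set q \<subseteq> Gamma_set q"
proof
  fix x assume "x \<in> Lambda_set q"
  then obtain L a t where x: "x = L mod (q\<^sup>2 - 1)" and t: "t > 0" "t dvd a\<^sup>2 + 1" "coprime (a * q) t"
    and L: "of_int L = of_int ((q\<^sup>2 - 1) * a) / of_int t - of_int q * norm_dedekind_sum (a * q) t"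
    unfolding Lambda_set_def by blast
  have L3: "3 dvd L" if "\<not> 3 dvd q" using Lambda_value_dvd_3[OF t that L] .
  have L8: "8 dvd L" if odd: "odd q"
  proof -
    obtain r where r: "q = r\<^sup>2" using q(2) odd by (auto simp: is_nth_power_def)
    moreover have "odd r" using odd r by simp
    ultimately show ?thesis using Lambda_value_dvd_8[of r t a L] t L by simp
  qed
  define N where "N = q\<^sup>2 - 1"
  have N: "N > 1"
    using power_mono[of 2 q 2] q(1) by (simp add: N_def)
  have g3: "gcd 3 N dvd L"
  proof (cases "3 dvd q")
    case True
    hence "\<not> 3 dvd N" unfolding N_def by (auto simp: power2_eq_square dvd_diff_right_iff)
    hence "coprime 3 N" by (simp add: prime_imp_coprime)
    thus ?thesis by simp
  next
    case False
    thus ?thesis using L3 dvd_trans[of "gcd 3 N" 3 L] by simp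
  qed
  have g8: "gcd 8 N dvd L"
  proof (cases "even q")
    case True
    hence "odd N" by (simp add: N_def)
    hence "coprime 8 N" using coprime_power_left_iff[of 2 3 N] by simp
    thus ?thesis by simp
  next
    case False
    thus ?thesis using L8 dvd_trans[of "gcd 8 N" 8 L] by simp
  qed
  have "coprime (3::int) (2 ^ 3)" unfolding coprime_power_right_iff by simp
  hence "coprime (3::int) 8" by simp
  hence "coprime (gcd 3 N) (gcd 8 N)" by (meson coprime_divisors gcd_dvd1)
  hence "gcd 3 N * gcd 8 N dvd L" using g3 g8 by (simp add: divides_mult)
  moreover have "gcd 24 N dvd gcd 3 N * gcd 8 N"
  proof -
    obtain u v where uv: "u * 3 + v * N = gcd 3 N" using bezout_int by blast
    obtain w z where wz: "w * 8 + z * N = gcd 8 N" using bezout_int by blast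
    have "gcd 3 N * gcd 8 N = 24 * (u * w) + N * (u * 3 * z + v * (w * 8 + z * N))"
      unfolding uv[symmetric] wz[symmetric] by (simp add: algebra_simps)
    thus ?thesis by (metis dvd_add dvd_mult2 gcd_dvd1 gcd_dvd2)
  qed
  ultimately have "gcd 24 N dvd L" by (rule dvd_trans[rotated])
  then obtain c where c: "L = gcd 24 N * c" by blast
  obtain y where y: "[24 * y = gcd 24 N] (mod N)" using cong_solve_int[of 24 N] by auto
  have "[24 * (y * c) = L] (mod N)" using cong_scalar_right[OF y, of c] c by (simp add: mult.assoc)
  hence s: "x = (24 * s) mod N" if "[s = y * c] (mod N)" for s
    using that cong_scalar_left[OF that, of 24] by (simp add: x N_def cong_def)
  \<comment> \<open>A multiple of 24 is also a multiple of 12.\<close>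
  have s': "x = (12 * s) mod N" if "[s = 2 * (y * c)] (mod N)" for s
    using s[of "y * c"] cong_scalar_left[OF that, of 12] by (simp add: cong_def)
  have carrier: "carrier (residue_ring N) = {0..N - 1}"
    by (simp add: residue_ring_def)
  show "x \<in> Gamma_set q"
  proof (cases "is_square q")
    case True
    have "(y * c) mod N \<in> {0..N - 1}"
      using N by simp
    moreover have "x = (24 * ((y * c) mod N)) mod N"
      by (rule s) (simp add: cong_def)
    ultimately show ?thesis using True unfolding Gamma_set_def N_def[symmetric] carrier by auto
  next
    case False
    have "(2 * (y * c)) mod N \<in> {0..N - 1}"
      using N by simp
    moreover have "x = (12 * ((2 * (y * c)) mod N)) mod N"
      by (rule s') (simp add: cong_def)
    ultimately show ?thesis using False unfolding Gamma_set_def N_def[symmetric] carrier by auto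
  qed
qed

theorem theorem4p4:
  fixes q :: int
  assumes "q \<ge> 2"
    and "even q \<or> (is_square q \<and> (3 dvd q \<or> 5 dvd q))"
  shows "Lambda_set q = Gamma_set q \<and>
    (\<forall>k::int. coprime k q \<longrightarrow>
      ((\<exists>a b::int. b \<ge> 1 \<and> coprime a b \<and> norm_dedekind_sum a b = of_int k / of_int q) \<longleftrightarrow>
        (\<not> 3 dvd q \<longrightarrow> 3 dvd k) \<and>
        (\<not> 2 dvd q \<longrightarrow>
          ([q = 3] (mod 4) \<longrightarrow> [k = 2] (mod 4)) \<and>
          (is_square q \<longrightarrow> [k = 0] (mod 8)) \<and>
          (\<not> [q = 3] (mod 4) \<and> \<not> is_square q \<longrightarrow> [k = 0] (mod 4)))))"
proof (intro conjI allI impI)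
  show "Lambda_set q = Gamma_set q"
    using Lambda_subset_Gamma[of q] Gamma_subset_Lambda[of q] assms by auto
next
  fix k :: int assume k: "coprime k q"
  have q: "q > 0" using assms(1) by simp
  \<comment> \<open>An odd \<open>q\<close> is a square here, hence 1 modulo 8, so the clause for
    odd \<open>q\<close> amounts to \<open>8 dvd k\<close>.\<close>
  have not3: "\<not> [q = 3] (mod 4)" if odd: "odd q"
  proof -
    obtain r where r: "q = r\<^sup>2" using assms(2) odd by (auto simp: is_nth_power_def)
    have "[q = 1] (mod 8)" using odd_square_mod_8[of r] r odd by simp
    hence "q mod 8 = 1" by (simp add: cong_def)
    thus ?thesis unfolding cong_def by presburger
  qed
  have sq: "is_square q" if "odd q" using assms(2) that by simp
  have "(\<exists>a b::int. b \<ge> 1 \<and> coprime a b \<and> norm_dedekind_sum a b = of_int k / of_int q) \<longleftrightarrow>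
      (\<not> 3 dvd q \<longrightarrow> 3 dvd k) \<and> (odd q \<longrightarrow> 8 dvd k)"
  proof
    assume "\<exists>a b::int. b \<ge> 1 \<and> coprime a b \<and> norm_dedekind_sum a b = of_int k / of_int q"
    then obtain a b where ab: "b > 0" "coprime a b" "norm_dedekind_sum a b = of_int k / of_int q"
      by (metis int_one_le_iff_zero_less)
    show "(\<not> 3 dvd q \<longrightarrow> 3 dvd k) \<and> (odd q \<longrightarrow> 8 dvd k)"
      using dedekind_value_necessary[OF ab(1,2) q k ab(3)] sq by blast
  next
    assume "(\<not> 3 dvd q \<longrightarrow> 3 dvd k) \<and> (odd q \<longrightarrow> 8 dvd k)"
    thus "\<exists>a b::int. b \<ge> 1 \<and> coprime a b \<and> norm_dedekind_sum a b = of_int k / of_int q"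
      using dedekind_value_exists[OF q k assms(2)] by blast
  qed
  thus "(\<exists>a b::int. b \<ge> 1 \<and> coprime a b \<and> norm_dedekind_sum a b = of_int k / of_int q) \<longleftrightarrow>
        (\<not> 3 dvd q \<longrightarrow> 3 dvd k) \<and>
        (\<not> 2 dvd q \<longrightarrow>
          ([q = 3] (mod 4) \<longrightarrow> [k = 2] (mod 4)) \<and>
          (is_square q \<longrightarrow> [k = 0] (mod 8)) \<and>
          (\<not> [q = 3] (mod 4) \<and> \<not> is_square q \<longrightarrow> [k = 0] (mod 4)))"
    using not3 sq by (auto simp: cong_0_iff)
qed

end
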